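(* Let $D(a,\sigma)$ be a generalized Weyl algebra of infinite degree $\alpha$ (an infinite ordinal) with base ring $D$. Then $D(a,\sigma)$ is not Noetherian. If $D$ is a domain, then $D(a,\sigma)$ is a domain. If $D$ is a Noetherian domain, then $D(a,\sigma)$ is an Ore domain.
   Context: Rings are $\mathsf{k}$-algebras over an arbitrary field $\mathsf{k}$ (not necessarily commutative). Generalized Weyl algebra (GWA): let $D$ be a ring, $\alpha$ an ordinal, $\sigma=\langle\sigma_\beta\rangle_{\beta<\alpha}$ commuting automorphisms of $D$, and $a=\langle a_\beta\rangle_{\beta<\alpha}$ nonzero elements of the center of $D$ with $\sigma_\beta(a_\gamma)=a_\gamma$ for $\gamma\neq\beta$. The GWA $D(a,\sigma)$ of degree $\alpha$ and base ring $D$ is generated over $D$ by $X_\beta^+,X_\beta^-$ ($\beta<\alpha$) with relations $X_\beta^{+}d=\sigma_\beta(d)X_\beta^{+}$, $X_\beta^{-}d=\sigma_\beta^{-1}(d)X_\beta^{-}$ for $d\in D$; $[X_\beta^+,X_\gamma^+]=[X_\beta^-,X_\gamma^-]=[X_\beta^+,X_\gamma^-]=0$ for $\beta\neq\gamma$; $X_\beta^-X_\beta^+=a_\beta$, $X_\beta^+X_\beta^-=\sigma_\beta(a_\beta)$. *)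

theory Defs
  imports "HOL-Algebra.Module" "HOL-Algebra.QuotRing"
begin

section \<open>Noncommutative ring theory\<close>

(* The algebra, domain and noetherian_ring locales of HOL-Algebra are not usable here: the first two
   require commutativity, and the third one only speaks about two-sided ideals. *)

locale nc_algebra = K?: field K + module K A + A?: ring A for K and A (structure) +
  assumes smult_mult_left: "\<lbrakk>c \<in> carrier K; x \<in> carrier A; y \<in> carrier A\<rbrakk> \<Longrightarrow>
      (c \<odot>\<^bsub>A\<^esub> x) \<otimes>\<^bsub>A\<^esub> y = c \<odot>\<^bsub>A\<^esub> (x \<otimes>\<^bsub>A\<^esub> y)"
    and smult_mult_right: "\<lbrakk>c \<in> carrier K; x \<in> carrier A; y \<in> carrier A\<rbrakk> \<Longrightarrow>
      x \<otimes>\<^bsub>A\<^esub> (c \<odot>\<^bsub>A\<^esub> y) = c \<odot>\<^bsub>A\<^esub> (x \<otimes>\<^bsub>A\<^esub> y)"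

definition algebra_aut :: "('k, 'm) ring_scheme \<Rightarrow> ('k, 'd, 'n) module_scheme \<Rightarrow> ('d \<Rightarrow> 'd) set"
  where "algebra_aut K A = {f \<in> ring_iso A A.
    \<forall>c\<in>carrier K. \<forall>x\<in>carrier A. f (c \<odot>\<^bsub>A\<^esub> x) = c \<odot>\<^bsub>A\<^esub> f x}"

definition ring_center :: "('d, 'm) ring_scheme \<Rightarrow> 'd set"
  where "ring_center R = {z \<in> carrier R. \<forall>x\<in>carrier R. z \<otimes>\<^bsub>R\<^esub> x = x \<otimes>\<^bsub>R\<^esub> z}"

definition left_ideal :: "'d set \<Rightarrow> ('d, 'm) ring_scheme \<Rightarrow> bool"
  where "left_ideal I R \<longleftrightarrow>
    additive_subgroup I R \<and> (\<forall>x\<in>carrier R. \<forall>y\<in>I. x \<otimes>\<^bsub>R\<^esub> y \<in> I)"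

definition right_ideal :: "'d set \<Rightarrow> ('d, 'm) ring_scheme \<Rightarrow> bool"
  where "right_ideal I R \<longleftrightarrow>
    additive_subgroup I R \<and> (\<forall>x\<in>carrier R. \<forall>y\<in>I. y \<otimes>\<^bsub>R\<^esub> x \<in> I)"

definition left_noetherian :: "('d, 'm) ring_scheme \<Rightarrow> bool"
  where "left_noetherian R \<longleftrightarrow>
    (\<forall>I::nat \<Rightarrow> 'd set. (\<forall>n. left_ideal (I n) R) \<and> (\<forall>n. I n \<subseteq> I (Suc n)) \<longrightarrow>
      (\<exists>N. \<forall>n\<ge>N. I n = I N))"

definition right_noetherian :: "('d, 'm) ring_scheme \<Rightarrow> bool"
  where "right_noetherian R \<longleftrightarrow>
    (\<forall>I::nat \<Rightarrow> 'd set. (\<forall>n. right_ideal (I n) R) \<and> (\<forall>n. I n \<subseteq> I (Suc n)) \<longrightarrow>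
      (\<exists>N. \<forall>n\<ge>N. I n = I N))"

definition noetherian :: "('d, 'm) ring_scheme \<Rightarrow> bool"
  where "noetherian R \<longleftrightarrow> left_noetherian R \<and> right_noetherian R"

locale nc_domain = ring R for R (structure) +
  assumes one_not_zero: "\<one> \<noteq> \<zero>"
    and integral: "\<lbrakk>x \<in> carrier R; y \<in> carrier R; x \<otimes> y = \<zero>\<rbrakk> \<Longrightarrow> x = \<zero> \<or> y = \<zero>"

locale ore_domain = nc_domain +
  assumes left_ore: "\<lbrakk>x \<in> carrier R - {\<zero>}; y \<in> carrier R - {\<zero>}\<rbrakk> \<Longrightarrow>
      \<exists>u\<in>carrier R. \<exists>v\<in>carrier R. u \<otimes> x = v \<otimes> y \<and> u \<otimes> x \<noteq> \<zero>"
    and right_ore: "\<lbrakk>x \<in> carrier R - {\<zero>}; y \<in> carrier R - {\<zero>}\<rbrakk> \<Longrightarrow>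
      \<exists>u\<in>carrier R. \<exists>v\<in>carrier R. x \<otimes> u = y \<otimes> v \<and> x \<otimes> u \<noteq> \<zero>"


section \<open>Generalized Weyl algebras\<close>

(* The ordinal \<alpha> is given by a well-order of that type; Field \<alpha> is the index set {\<beta>. \<beta> < \<alpha>}. *)

locale gwa_data = nc_algebra K D
  for K :: "('k, 'm) ring_scheme" and D :: "('k, 'd, 'n) module_scheme" (structure) +
  fixes \<alpha> :: "'i rel" and a :: "'i \<Rightarrow> 'd" and \<sigma> :: "'i \<Rightarrow> 'd \<Rightarrow> 'd"
  assumes well_order: "Well_order \<alpha>"
    and sigma_aut: "\<beta> \<in> Field \<alpha> \<Longrightarrow> \<sigma> \<beta> \<in> algebra_aut K D"
    and sigma_commute: "\<lbrakk>\<beta> \<in> Field \<alpha>; \<gamma> \<in> Field \<alpha>; d \<in> carrier D\<rbrakk> \<Longrightarrow>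
      \<sigma> \<beta> (\<sigma> \<gamma> d) = \<sigma> \<gamma> (\<sigma> \<beta> d)"
    and a_center: "\<beta> \<in> Field \<alpha> \<Longrightarrow> a \<beta> \<in> ring_center D"
    and a_nonzero: "\<beta> \<in> Field \<alpha> \<Longrightarrow> a \<beta> \<noteq> \<zero>\<^bsub>D\<^esub>"
    and sigma_a: "\<lbrakk>\<beta> \<in> Field \<alpha>; \<gamma> \<in> Field \<alpha>; \<gamma> \<noteq> \<beta>\<rbrakk> \<Longrightarrow> \<sigma> \<beta> (a \<gamma>) = a \<gamma>"

(* D(a, \<sigma>) is the quotient of the algebra of all ring expressions in the elements of D and the
   generators X by the smallest congruence gwa_eq that contains the ring axioms, the identities
   of D, and the defining relations. No relations for the field K are needed: its scalars are
   elements of the center of D fixed by all \<sigma> \<beta>, so they become central in the quotient. *)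

datatype ('d, 'i) gwa_term =
    Const 'd
  | XPlus 'i
  | XMinus 'i
  | Plus "('d, 'i) gwa_term" "('d, 'i) gwa_term"
  | Minus "('d, 'i) gwa_term"
  | Times "('d, 'i) gwa_term" "('d, 'i) gwa_term"

inductive_set gwa_terms :: "('d, 'm) ring_scheme \<Rightarrow> 'i rel \<Rightarrow> ('d, 'i) gwa_term set"
  for D :: "('d, 'm) ring_scheme" and \<alpha> :: "'i rel"
  where
    Const: "d \<in> carrier D \<Longrightarrow> Const d \<in> gwa_terms D \<alpha>"
  | XPlus: "\<beta> \<in> Field \<alpha> \<Longrightarrow> XPlus \<beta> \<in> gwa_terms D \<alpha>"
  | XMinus: "\<beta> \<in> Field \<alpha> \<Longrightarrow> XMinus \<beta> \<in> gwa_terms D \<alpha>"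
  | Plus: "\<lbrakk>s \<in> gwa_terms D \<alpha>; t \<in> gwa_terms D \<alpha>\<rbrakk> \<Longrightarrow> Plus s t \<in> gwa_terms D \<alpha>"
  | Minus: "s \<in> gwa_terms D \<alpha> \<Longrightarrow> Minus s \<in> gwa_terms D \<alpha>"
  | Times: "\<lbrakk>s \<in> gwa_terms D \<alpha>; t \<in> gwa_terms D \<alpha>\<rbrakk> \<Longrightarrow> Times s t \<in> gwa_terms D \<alpha>"

inductive gwa_eq :: "('d, 'm) ring_scheme \<Rightarrow> 'i rel \<Rightarrow> ('i \<Rightarrow> 'd) \<Rightarrow> ('i \<Rightarrow> 'd \<Rightarrow> 'd) \<Rightarrow>
    ('d, 'i) gwa_term \<Rightarrow> ('d, 'i) gwa_term \<Rightarrow> bool"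
  for D :: "('d, 'm) ring_scheme" and \<alpha> :: "'i rel" and a :: "'i \<Rightarrow> 'd" and \<sigma> :: "'i \<Rightarrow> 'd \<Rightarrow> 'd"
  where
    (* congruence *)
    refl: "t \<in> gwa_terms D \<alpha> \<Longrightarrow> gwa_eq D \<alpha> a \<sigma> t t"
  | sym: "gwa_eq D \<alpha> a \<sigma> s t \<Longrightarrow> gwa_eq D \<alpha> a \<sigma> t s"
  | trans: "\<lbrakk>gwa_eq D \<alpha> a \<sigma> s t; gwa_eq D \<alpha> a \<sigma> t u\<rbrakk> \<Longrightarrow> gwa_eq D \<alpha> a \<sigma> s u"
  | Plus_cong: "\<lbrakk>gwa_eq D \<alpha> a \<sigma> s s'; gwa_eq D \<alpha> a \<sigma> t t'\<rbrakk> \<Longrightarrow>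
      gwa_eq D \<alpha> a \<sigma> (Plus s t) (Plus s' t')"
  | Minus_cong: "gwa_eq D \<alpha> a \<sigma> s s' \<Longrightarrow> gwa_eq D \<alpha> a \<sigma> (Minus s) (Minus s')"
  | Times_cong: "\<lbrakk>gwa_eq D \<alpha> a \<sigma> s s'; gwa_eq D \<alpha> a \<sigma> t t'\<rbrakk> \<Longrightarrow>
      gwa_eq D \<alpha> a \<sigma> (Times s t) (Times s' t')"
    (* ring axioms *)
  | Plus_assoc: "\<lbrakk>s \<in> gwa_terms D \<alpha>; t \<in> gwa_terms D \<alpha>; u \<in> gwa_terms D \<alpha>\<rbrakk> \<Longrightarrow>
      gwa_eq D \<alpha> a \<sigma> (Plus (Plus s t) u) (Plus s (Plus t u))"
  | Plus_comm: "\<lbrakk>s \<in> gwa_terms D \<alpha>; t \<in> gwa_terms D \<alpha>\<rbrakk> \<Longrightarrow>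
      gwa_eq D \<alpha> a \<sigma> (Plus s t) (Plus t s)"
  | Plus_zero: "s \<in> gwa_terms D \<alpha> \<Longrightarrow> gwa_eq D \<alpha> a \<sigma> (Plus (Const \<zero>\<^bsub>D\<^esub>) s) s"
  | Plus_Minus: "s \<in> gwa_terms D \<alpha> \<Longrightarrow> gwa_eq D \<alpha> a \<sigma> (Plus (Minus s) s) (Const \<zero>\<^bsub>D\<^esub>)"
  | Times_assoc: "\<lbrakk>s \<in> gwa_terms D \<alpha>; t \<in> gwa_terms D \<alpha>; u \<in> gwa_terms D \<alpha>\<rbrakk> \<Longrightarrow>
      gwa_eq D \<alpha> a \<sigma> (Times (Times s t) u) (Times s (Times t u))"
  | Times_one_left: "s \<in> gwa_terms D \<alpha> \<Longrightarrow> gwa_eq D \<alpha> a \<sigma> (Times (Const \<one>\<^bsub>D\<^esub>) s) s"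
  | Times_one_right: "s \<in> gwa_terms D \<alpha> \<Longrightarrow> gwa_eq D \<alpha> a \<sigma> (Times s (Const \<one>\<^bsub>D\<^esub>)) s"
  | distrib_right: "\<lbrakk>s \<in> gwa_terms D \<alpha>; t \<in> gwa_terms D \<alpha>; u \<in> gwa_terms D \<alpha>\<rbrakk> \<Longrightarrow>
      gwa_eq D \<alpha> a \<sigma> (Times (Plus s t) u) (Plus (Times s u) (Times t u))"
  | distrib_left: "\<lbrakk>s \<in> gwa_terms D \<alpha>; t \<in> gwa_terms D \<alpha>; u \<in> gwa_terms D \<alpha>\<rbrakk> \<Longrightarrow>
      gwa_eq D \<alpha> a \<sigma> (Times u (Plus s t)) (Plus (Times u s) (Times u t))"
    (* identities of the base ring *)
  | Const_add: "\<lbrakk>d \<in> carrier D; e \<in> carrier D\<rbrakk> \<Longrightarrow>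
      gwa_eq D \<alpha> a \<sigma> (Const (d \<oplus>\<^bsub>D\<^esub> e)) (Plus (Const d) (Const e))"
  | Const_mult: "\<lbrakk>d \<in> carrier D; e \<in> carrier D\<rbrakk> \<Longrightarrow>
      gwa_eq D \<alpha> a \<sigma> (Const (d \<otimes>\<^bsub>D\<^esub> e)) (Times (Const d) (Const e))"
    (* defining relations *)
  | XPlus_Const: "\<lbrakk>\<beta> \<in> Field \<alpha>; d \<in> carrier D\<rbrakk> \<Longrightarrow>
      gwa_eq D \<alpha> a \<sigma> (Times (XPlus \<beta>) (Const d)) (Times (Const (\<sigma> \<beta> d)) (XPlus \<beta>))"
  | XMinus_Const: "\<lbrakk>\<beta> \<in> Field \<alpha>; d \<in> carrier D\<rbrakk> \<Longrightarrow>
      gwa_eq D \<alpha> a \<sigma> (Times (XMinus \<beta>) (Const d))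
        (Times (Const (inv_into (carrier D) (\<sigma> \<beta>) d)) (XMinus \<beta>))"
  | XPlus_XPlus: "\<lbrakk>\<beta> \<in> Field \<alpha>; \<gamma> \<in> Field \<alpha>; \<beta> \<noteq> \<gamma>\<rbrakk> \<Longrightarrow>
      gwa_eq D \<alpha> a \<sigma> (Times (XPlus \<beta>) (XPlus \<gamma>)) (Times (XPlus \<gamma>) (XPlus \<beta>))"
  | XMinus_XMinus: "\<lbrakk>\<beta> \<in> Field \<alpha>; \<gamma> \<in> Field \<alpha>; \<beta> \<noteq> \<gamma>\<rbrakk> \<Longrightarrow>
      gwa_eq D \<alpha> a \<sigma> (Times (XMinus \<beta>) (XMinus \<gamma>)) (Times (XMinus \<gamma>) (XMinus \<beta>))"
  | XPlus_XMinus: "\<lbrakk>\<beta> \<in> Field \<alpha>; \<gamma> \<in> Field \<alpha>; \<beta> \<noteq> \<gamma>\<rbrakk> \<Longrightarrow>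
      gwa_eq D \<alpha> a \<sigma> (Times (XPlus \<beta>) (XMinus \<gamma>)) (Times (XMinus \<gamma>) (XPlus \<beta>))"
  | XMinus_XPlus_same: "\<beta> \<in> Field \<alpha> \<Longrightarrow>
      gwa_eq D \<alpha> a \<sigma> (Times (XMinus \<beta>) (XPlus \<beta>)) (Const (a \<beta>))"
  | XPlus_XMinus_same: "\<beta> \<in> Field \<alpha> \<Longrightarrow>
      gwa_eq D \<alpha> a \<sigma> (Times (XPlus \<beta>) (XMinus \<beta>)) (Const (\<sigma> \<beta> (a \<beta>)))"

definition gwa_class :: "('d, 'm) ring_scheme \<Rightarrow> 'i rel \<Rightarrow> ('i \<Rightarrow> 'd) \<Rightarrow> ('i \<Rightarrow> 'd \<Rightarrow> 'd) \<Rightarrow>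
    ('d, 'i) gwa_term \<Rightarrow> ('d, 'i) gwa_term set"
  where "gwa_class D \<alpha> a \<sigma> t = {s. gwa_eq D \<alpha> a \<sigma> t s}"

(* In add and mult, all sets in the union are equal since gwa_eq is a congruence. *)

definition GWA :: "('d, 'm) ring_scheme \<Rightarrow> 'i rel \<Rightarrow> ('i \<Rightarrow> 'd) \<Rightarrow> ('i \<Rightarrow> 'd \<Rightarrow> 'd) \<Rightarrow>
    ('d, 'i) gwa_term set ring"
  where "GWA D \<alpha> a \<sigma> =
    \<lparr> carrier = gwa_class D \<alpha> a \<sigma> ` gwa_terms D \<alpha>,
      monoid.mult = (\<lambda>P Q. \<Union>s\<in>P. \<Union>t\<in>Q. gwa_class D \<alpha> a \<sigma> (Times s t)),
      one = gwa_class D \<alpha> a \<sigma> (Const \<one>\<^bsub>D\<^esub>),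
      ring.zero = gwa_class D \<alpha> a \<sigma> (Const \<zero>\<^bsub>D\<^esub>),
      add = (\<lambda>P Q. \<Union>s\<in>P. \<Union>t\<in>Q. gwa_class D \<alpha> a \<sigma> (Plus s t)) \<rparr>"

lemma gwa_class_eq:
  assumes "gwa_eq D \<alpha> a \<sigma> s t"
  shows "gwa_class D \<alpha> a \<sigma> s = gwa_class D \<alpha> a \<sigma> t"
proof -
  have "gwa_eq D \<alpha> a \<sigma> s u \<longleftrightarrow> gwa_eq D \<alpha> a \<sigma> t u" for u
    using gwa_eq.trans[OF assms, of u] gwa_eq.trans[OF gwa_eq.sym[OF assms], of u] by argo
  then show ?thesis by (simp only: gwa_class_def)
qed

lemma gwa_class_self: "t \<in> gwa_terms D \<alpha> \<Longrightarrow> t \<in> gwa_class D \<alpha> a \<sigma> t"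
  unfolding gwa_class_def by (intro CollectI gwa_eq.refl)

lemma mult_gwa_class:
  assumes "s \<in> gwa_terms D \<alpha>" "t \<in> gwa_terms D \<alpha>"
  shows "gwa_class D \<alpha> a \<sigma> s \<otimes>\<^bsub>GWA D \<alpha> a \<sigma>\<^esub> gwa_class D \<alpha> a \<sigma> t = gwa_class D \<alpha> a \<sigma> (Times s t)"
proof -
  let ?S = "gwa_class D \<alpha> a \<sigma> s" and ?T = "gwa_class D \<alpha> a \<sigma> t"
  have eq: "gwa_class D \<alpha> a \<sigma> (Times s' t') = gwa_class D \<alpha> a \<sigma> (Times s t)"
    if "s' \<in> ?S" "t' \<in> ?T" for s' t'
    using that gwa_class_eq[OF gwa_eq.Times_cong, of D \<alpha> a \<sigma> s s' t t']
    by (simp only: gwa_class_def mem_Collect_eq)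
  have "?S \<otimes>\<^bsub>GWA D \<alpha> a \<sigma>\<^esub> ?T = (\<Union>s'\<in>?S. \<Union>t'\<in>?T. gwa_class D \<alpha> a \<sigma> (Times s' t'))"
    by (simp add: GWA_def)
  also have "\<dots> = (\<Union>s'\<in>?S. \<Union>t'\<in>?T. gwa_class D \<alpha> a \<sigma> (Times s t))"
    by (intro SUP_cong HOL.refl eq)
  also have "\<dots> = gwa_class D \<alpha> a \<sigma> (Times s t)"
    using gwa_class_self[OF assms(1)] gwa_class_self[OF assms(2)] by fast
  finally show ?thesis .
qed

lemma add_gwa_class:
  assumes "s \<in> gwa_terms D \<alpha>" "t \<in> gwa_terms D \<alpha>"
  shows "gwa_class D \<alpha> a \<sigma> s \<oplus>\<^bsub>GWA D \<alpha> a \<sigma>\<^esub> gwa_class D \<alpha> a \<sigma> t = gwa_class D \<alpha> a \<sigma> (Plus s t)"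
proof -
  let ?S = "gwa_class D \<alpha> a \<sigma> s" and ?T = "gwa_class D \<alpha> a \<sigma> t"
  have eq: "gwa_class D \<alpha> a \<sigma> (Plus s' t') = gwa_class D \<alpha> a \<sigma> (Plus s t)"
    if "s' \<in> ?S" "t' \<in> ?T" for s' t'
    using that gwa_class_eq[OF gwa_eq.Plus_cong, of D \<alpha> a \<sigma> s s' t t']
    by (simp only: gwa_class_def mem_Collect_eq)
  have "?S \<oplus>\<^bsub>GWA D \<alpha> a \<sigma>\<^esub> ?T = (\<Union>s'\<in>?S. \<Union>t'\<in>?T. gwa_class D \<alpha> a \<sigma> (Plus s' t'))"
    by (simp add: GWA_def)
  also have "\<dots> = (\<Union>s'\<in>?S. \<Union>t'\<in>?T. gwa_class D \<alpha> a \<sigma> (Plus s t))"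
    by (intro SUP_cong HOL.refl eq)
  also have "\<dots> = gwa_class D \<alpha> a \<sigma> (Plus s t)"
    using gwa_class_self[OF assms(1)] gwa_class_self[OF assms(2)] by fast
  finally show ?thesis .
qed

lemma ring_GWA:
  assumes "ring D"
  shows "ring (GWA D \<alpha> a \<sigma>)"
proof -
  interpret D: ring D by fact
  have car: "carrier (GWA D \<alpha> a \<sigma>) = gwa_class D \<alpha> a \<sigma> ` gwa_terms D \<alpha>"
    and one: "\<one>\<^bsub>GWA D \<alpha> a \<sigma>\<^esub> = gwa_class D \<alpha> a \<sigma> (Const \<one>\<^bsub>D\<^esub>)"
    and zero: "\<zero>\<^bsub>GWA D \<alpha> a \<sigma>\<^esub> = gwa_class D \<alpha> a \<sigma> (Const \<zero>\<^bsub>D\<^esub>)"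
    by (auto simp: GWA_def)
  note ops = mult_gwa_class add_gwa_class gwa_terms.intros
  have "abelian_group (GWA D \<alpha> a \<sigma>)"
  proof (rule abelian_groupI)
    fix x assume "x \<in> carrier (GWA D \<alpha> a \<sigma>)"
    then obtain s where s: "s \<in> gwa_terms D \<alpha>" "x = gwa_class D \<alpha> a \<sigma> s"
      by (auto simp: car)
    then have "gwa_class D \<alpha> a \<sigma> (Minus s) \<oplus>\<^bsub>GWA D \<alpha> a \<sigma>\<^esub> x = \<zero>\<^bsub>GWA D \<alpha> a \<sigma>\<^esub>"
      by (simp add: ops zero gwa_class_eq[OF gwa_eq.Plus_Minus])
    then show "\<exists>y\<in>carrier (GWA D \<alpha> a \<sigma>). y \<oplus>\<^bsub>GWA D \<alpha> a \<sigma>\<^esub> x = \<zero>\<^bsub>GWA D \<alpha> a \<sigma>\<^esub>"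
      using s by (auto simp: car intro: gwa_terms.intros)
  next
    fix x y assume "x \<in> carrier (GWA D \<alpha> a \<sigma>)" "y \<in> carrier (GWA D \<alpha> a \<sigma>)"
    then show "x \<oplus>\<^bsub>GWA D \<alpha> a \<sigma>\<^esub> y = y \<oplus>\<^bsub>GWA D \<alpha> a \<sigma>\<^esub> x"
      by (auto simp: car ops gwa_class_eq[OF gwa_eq.Plus_comm])
  qed (auto simp: car zero ops gwa_class_eq[OF gwa_eq.Plus_zero]
      gwa_class_eq[OF gwa_eq.Plus_assoc])
  moreover have "monoid (GWA D \<alpha> a \<sigma>)"
    by (rule monoidI) (auto simp: car one ops gwa_class_eq[OF gwa_eq.Times_one_left]
      gwa_class_eq[OF gwa_eq.Times_one_right] gwa_class_eq[OF gwa_eq.Times_assoc])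
  ultimately show ?thesis
    by (rule ringI) (auto simp: car ops gwa_class_eq[OF gwa_eq.distrib_left]
      gwa_class_eq[OF gwa_eq.distrib_right])
qed

end

theory Submission
  imports Defs "HOL-Library.Function_Algebras"
begin

text \<open>A generalized Weyl algebra acts on the functions of the degree like the skew Laurent polynomial
  ring in the variables \<open>t\<^sub>\<beta>\<close>, with \<open>X\<^sub>\<beta>\<^sup>+ \<mapsto> t\<^sub>\<beta>\<close> and \<open>X\<^sub>\<beta>\<^sup>- \<mapsto> a\<^sub>\<beta> t\<^sub>\<beta>\<^sup>-\<^sup>1\<close>. Take distinct
  indices \<open>\<beta>\<^sub>0, \<beta>\<^sub>1, \<dots>\<close>. The annihilators of the zero-one-valued functions that are invariant under
  translation in the directions \<open>\<beta>\<^sub>0, \<dots>, \<beta>\<^sub>n\<^sub>-\<^sub>1\<close> form a chain of left ideals, and it increases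
  strictly because \<open>X\<^sub>\<beta>\<^sup>+ - 1\<close> for \<open>\<beta> = \<beta>\<^sub>n\<close> enters at step \<open>n + 1\<close>. If \<open>D\<close> is a domain, the reduced
  monomials are a basis over \<open>D\<close>, and two nonzero elements have a nonzero product because some sum of
  a degree of the first and a degree of the second arises in only one way. A Noetherian domain is
  Ore. The Ore condition passes from \<open>D\<close> to the algebra by counting: for a finite set \<open>S\<close> of degrees
  some finite set \<open>U\<close> satisfies \<open>|U + S| < 2 |U|\<close>, so the linear system for the coefficients of a
  common multiple has more unknowns than equations.\<close>

section \<open>Ore domains and linear systems\<close>

definition opposite :: "('d, 'm) ring_scheme \<Rightarrow> ('d, 'm) ring_scheme"
  where "opposite R = R\<lparr>monoid.mult := (\<lambda>x y. y \<otimes>\<^bsub>R\<^esub> x)\<rparr>"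

lemma opposite_simps [simp]:
  "carrier (opposite R) = carrier R"
  "x \<otimes>\<^bsub>opposite R\<^esub> y = y \<otimes>\<^bsub>R\<^esub> x"
  "\<one>\<^bsub>opposite R\<^esub> = \<one>\<^bsub>R\<^esub>"
  "\<zero>\<^bsub>opposite R\<^esub> = \<zero>\<^bsub>R\<^esub>"
  "add (opposite R) = add R"
  by (simp_all add: opposite_def)

lemma finsum_opposite [simp]: "finsum (opposite R) = finsum R"
  by (simp add: finsum_def)

lemma ring_opposite:
  assumes "ring R"
  shows "ring (opposite R)"
proof -
  interpret ring R by fact
  have "abelian_group (opposite R)"
    by (rule comm_group_abelian_groupI) (simp add: add.comm_group_axioms)
  moreover have "monoid (opposite R)"
    by (rule monoidI) (auto simp: m_assoc)
  ultimately show ?thesis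
    by (rule ringI) (auto simp: l_distr r_distr)
qed

lemma nc_domain_opposite:
  assumes "nc_domain R"
  shows "nc_domain (opposite R)"
proof -
  interpret nc_domain R by fact
  show ?thesis
    using ring_opposite[OF ring_axioms] one_not_zero integral
    by (auto simp: nc_domain_def nc_domain_axioms_def)
qed

lemma left_ideal_opposite: "left_ideal I (opposite R) \<longleftrightarrow> right_ideal I R"
  by (simp add: left_ideal_def right_ideal_def additive_subgroup_def)

lemma left_noetherian_opposite: "left_noetherian (opposite R) \<longleftrightarrow> right_noetherian R"
  by (simp add: left_noetherian_def right_noetherian_def left_ideal_opposite)

text \<open>One half of the Ore condition as a predicate on rings, so that the other half is the
  same predicate for the opposite ring, see \<open>ore_domainI\<close>.\<close>

definition left_ore :: "('d, 'm) ring_scheme \<Rightarrow> bool"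
  where "left_ore R \<longleftrightarrow> (\<forall>x\<in>carrier R - {\<zero>\<^bsub>R\<^esub>}. \<forall>y\<in>carrier R - {\<zero>\<^bsub>R\<^esub>}.
    \<exists>u\<in>carrier R. \<exists>v\<in>carrier R. u \<otimes>\<^bsub>R\<^esub> x = v \<otimes>\<^bsub>R\<^esub> y \<and> u \<otimes>\<^bsub>R\<^esub> x \<noteq> \<zero>\<^bsub>R\<^esub>)"

lemma ore_domainI:
  assumes "nc_domain R" "left_ore R" "left_ore (opposite R)"
  shows "ore_domain R"
  using assms unfolding ore_domain_def ore_domain_axioms_def left_ore_def by simp

context nc_domain
begin

text \<open>If \<open>Rx \<inter> Ry = 0\<close>, then the sum of the left ideals \<open>R x y\<^sup>n\<close> is direct. Its partial sums
  \<open>I\<^sub>n\<close> satisfy \<open>I\<^sub>n\<^sub>+\<^sub>1 = Rx + I\<^sub>n y\<close>, so one coincidence \<open>I\<^sub>n\<^sub>+\<^sub>1 = I\<^sub>n\<close> can be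
  descended to \<open>I\<^sub>1 = I\<^sub>0\<close>.\<close>

lemma left_noetherian_imp_left_ore:
  assumes "left_noetherian R"
  shows "left_ore R"
  unfolding left_ore_def
proof (intro ballI, rule ccontr)
  fix x y
  assume x: "x \<in> carrier R - {\<zero>}" and y: "y \<in> carrier R - {\<zero>}"
    and no: "\<not> (\<exists>u\<in>carrier R. \<exists>v\<in>carrier R. u \<otimes> x = v \<otimes> y \<and> u \<otimes> x \<noteq> \<zero>)"
  define I where
    "I = rec_nat {\<zero>} (\<lambda>_ J. {d \<otimes> x \<oplus> z \<otimes> y | d z. d \<in> carrier R \<and> z \<in> J})"
  have I0: "I 0 = {\<zero>}"
    and IS: "I (Suc n) = {d \<otimes> x \<oplus> z \<otimes> y | d z. d \<in> carrier R \<and> z \<in> I n}" for n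
    by (simp_all add: I_def)
  have xc: "x \<in> carrier R" and yc: "y \<in> carrier R" using x y by auto
  have sub: "I n \<subseteq> carrier R" for n
    by (induction n) (use xc yc in \<open>auto simp: I0 IS\<close>)
  have zero: "\<zero> \<in> I n" for n
  proof (induction n)
    case (Suc n)
    then show ?case
      using xc yc by (auto simp: IS intro!: exI[of _ \<zero>])
  qed (simp add: I0)
  have add: "p \<oplus> q \<in> I n" if "p \<in> I n" "q \<in> I n" for p q n
    using that
  proof (induction n arbitrary: p q)
    case (Suc n)
    then obtain d z d' z' where dz: "p = d \<otimes> x \<oplus> z \<otimes> y" "q = d' \<otimes> x \<oplus> z' \<otimes> y"
      "d \<in> carrier R" "d' \<in> carrier R" "z \<in> I n" "z' \<in> I n"
      by (auto simp: IS)
    then have "z \<in> carrier R" "z' \<in> carrier R" using sub by auto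
    then have "p \<oplus> q = (d \<oplus> d') \<otimes> x \<oplus> (z \<oplus> z') \<otimes> y"
      using dz xc yc by (simp add: l_distr a_ac)
    then show ?case using dz Suc.IH[of z z'] by (auto simp: IS)
  qed (simp add: I0)
  have mul: "r \<otimes> p \<in> I n" if "r \<in> carrier R" "p \<in> I n" for r p n
    using that(2)
  proof (induction n arbitrary: p)
    case (Suc n)
    then obtain d z where dz: "p = d \<otimes> x \<oplus> z \<otimes> y" "d \<in> carrier R" "z \<in> I n"
      by (auto simp: IS)
    then have "z \<in> carrier R" using sub by auto
    then have "r \<otimes> p = (r \<otimes> d) \<otimes> x \<oplus> (r \<otimes> z) \<otimes> y"
      using dz xc yc that(1) by (simp add: r_distr m_assoc)
    then show ?case using dz Suc.IH[of z] that(1) by (auto simp: IS)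
  qed (use that(1) in \<open>simp add: I0\<close>)
  have neg: "\<ominus> p \<in> I n" if "p \<in> I n" for p n
    using mul[of "\<ominus> \<one>" p n] that sub[of n] by (auto simp: l_minus)
  have "left_ideal (I n) R" for n
    unfolding left_ideal_def
    by (auto simp: mul intro!: additive_subgroup.intro add.subgroupI add neg sub zero)
  moreover have mono: "I n \<subseteq> I (Suc n)" for n
  proof (induction n)
    case 0
    show ?case using zero[of "Suc 0"] by (simp add: I0)
  next
    case (Suc n)
    then show ?case by (subst (1 2) IS) auto
  qed
  ultimately obtain N where "\<forall>n\<ge>N. I n = I N"
    using assms unfolding left_noetherian_def by meson
  then have "I (Suc N) \<subseteq> I N" by (metis le_SucI order_refl)
  then have "I (Suc 0) \<subseteq> I 0"
  proof (induction N)
    case (Suc N)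
    have "z \<in> I N" if z: "z \<in> I (Suc N)" for z
    proof -
      have zc: "z \<in> carrier R" using z sub by auto
      have "z \<otimes> y \<in> I (Suc (Suc N))"
        unfolding IS[of "Suc N"] using z zc xc yc by (intro CollectI exI[of _ \<zero>] exI[of _ z]) simp
      then have "z \<otimes> y \<in> I (Suc N)" using Suc.prems by blast
      then obtain d z' where d: "z \<otimes> y = d \<otimes> x \<oplus> z' \<otimes> y" "d \<in> carrier R" "z' \<in> I N"
        by (auto simp: IS)
      have zc': "z' \<in> carrier R" using d sub by auto
      \<comment> \<open>This element lies in \<open>R x\<close> and in \<open>R y\<close>, so
        \<open>no\<close> makes it zero. Cancelling \<open>y\<close> leaves \<open>z = z'\<close>,
        and \<open>z'\<close> lies one step lower in the chain.\<close>
      have "(z \<ominus> z') \<otimes> y = d \<otimes> x"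
        using d zc zc' xc yc by (simp add: a_minus_def l_distr l_minus a_assoc r_neg)
      then have "(z \<ominus> z') \<otimes> y = \<zero>"
        using no d(2) zc zc' by (metis minus_closed)
      then have "z \<ominus> z' = \<zero>" using integral[of "z \<ominus> z'" y] zc zc' y by auto
      then have "z = z'" using zc zc' minus_equality[of z "\<ominus> z'"] by (simp add: a_minus_def)
      then show ?thesis using d by simp
    qed
    then show ?case using Suc.IH by blast
  qed simp
  moreover have "x \<in> I (Suc 0)"
    unfolding IS I0 using xc yc by (auto intro!: exI[of _ \<one>])
  ultimately show False using x I0 by auto
qed

end

section \<open>Linear systems over a left Ore domain\<close>

lemma (in abelian_monoid) finsum_swap:
  assumes "finite I" "finite J" "\<And>i j. i \<in> I \<Longrightarrow> j \<in> J \<Longrightarrow> f i j \<in> carrier G"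
  shows "(\<Oplus>i\<in>I. \<Oplus>j\<in>J. f i j) = (\<Oplus>j\<in>J. \<Oplus>i\<in>I. f i j)"
  using assms(1,3)
proof (induction I)
  case (insert k I)
  have "(\<Oplus>i\<in>insert k I. \<Oplus>j\<in>J. f i j) = (\<Oplus>j\<in>J. f k j) \<oplus> (\<Oplus>i\<in>I. \<Oplus>j\<in>J. f i j)"
    using insert by (subst finsum_insert) auto
  also have "\<dots> = (\<Oplus>j\<in>J. f k j \<oplus> (\<Oplus>i\<in>I. f i j))"
    using insert by (subst finsum_addf) auto
  also have "\<dots> = (\<Oplus>j\<in>J. \<Oplus>i\<in>insert k I. f i j)"
    using insert by (intro finsum_cong') auto
  finally show ?case .
qed (simp add: finsum_zero)

context nc_domain
begin

text \<open>Gaussian elimination, by induction on the set of equations. Without inverses a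
  coefficient cannot be cleared by division; instead it and the pivot coefficient are brought to a
  common left multiple. The unknowns stand to the left of the coefficients, so they absorb the
  multipliers.\<close>

lemma left_linear_system:
  assumes "left_ore R" "finite I" "finite J" "card I < card J"
    and "\<And>j i. j \<in> J \<Longrightarrow> i \<in> I \<Longrightarrow> c j i \<in> carrier R"
  shows "\<exists>x\<in>J \<rightarrow> carrier R. (\<exists>j\<in>J. x j \<noteq> \<zero>) \<and> (\<forall>i\<in>I. (\<Oplus>j\<in>J. x j \<otimes> c j i) = \<zero>)"
  using assms(2-)
proof (induction I arbitrary: J c)
  case empty
  then have "J \<noteq> {}" by auto
  then show ?case
    using one_not_zero by (intro bexI[of _ "\<lambda>_. \<one>"]) auto
next
  case (insert i I)
  show ?case
  proof (cases "\<forall>j\<in>J. c j i = \<zero>")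
    case True
    obtain x where x: "x \<in> J \<rightarrow> carrier R" "\<exists>j\<in>J. x j \<noteq> \<zero>"
      "\<forall>i\<in>I. (\<Oplus>j\<in>J. x j \<otimes> c j i) = \<zero>"
      using insert.IH[of J c] insert.prems insert.hyps by auto
    have "(\<Oplus>j\<in>J. x j \<otimes> c j i) = (\<Oplus>j\<in>J. \<zero>)"
      using x(1) True by (intro finsum_cong') (auto simp: Pi_iff)
    then show ?thesis using x by (intro bexI[of _ x]) (auto simp: finsum_zero)
  next
    case False
    then obtain p where p: "p \<in> J" "c p i \<noteq> \<zero>" by auto
    define J' where "J' = J - {p}"
    have fin: "finite J'" and J: "J = insert p J'" and pJ: "p \<notin> J'"
      using insert.prems p by (auto simp: J'_def)
    have cc: "c j k \<in> carrier R" if "j \<in> J" "k \<in> insert i I" for j k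
      using insert.prems that by auto
    \<comment> \<open>The pivot unknown is \<open>p\<close>. The multipliers bring
      \<open>c j i\<close> and \<open>c p i\<close> to a common left multiple. A vanishing
      \<open>c j i\<close> gets the multipliers one and zero, so \<open>u j\<close> is nonzero in
      every case; this later keeps the solution nonzero.\<close>
    have "\<exists>u w. u \<in> carrier R \<and> w \<in> carrier R \<and> u \<noteq> \<zero> \<and> u \<otimes> c j i = w \<otimes> c p i"
      if j: "j \<in> J'" for j
    proof (cases "c j i = \<zero>")
      case True
      then show ?thesis
        using one_not_zero cc p by (intro exI[of _ \<one>] exI[of _ \<zero>]) auto
    next
      case False
      then obtain u w where uw: "u \<in> carrier R" "w \<in> carrier R" "u \<otimes> c j i = w \<otimes> c p i"
        "u \<otimes> c j i \<noteq> \<zero>"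
        using assms(1) cc p j unfolding left_ore_def J'_def by (metis DiffD1 DiffI insertI1 singletonD)
      moreover have "u \<noteq> \<zero>" using uw cc[of j i] j by (auto simp: J)
      ultimately show ?thesis by blast
    qed
    then obtain u w where u: "\<And>j. j \<in> J' \<Longrightarrow> u j \<in> carrier R"
      and w: "\<And>j. j \<in> J' \<Longrightarrow> w j \<in> carrier R"
      and u0: "\<And>j. j \<in> J' \<Longrightarrow> u j \<noteq> \<zero>"
      and uw: "\<And>j. j \<in> J' \<Longrightarrow> u j \<otimes> c j i = w j \<otimes> c p i"
      by metis
    have cJ: "c j k \<in> carrier R" if "j \<in> J'" "k \<in> insert i I" for j k
      using cc that J by auto
    have cp: "c p k \<in> carrier R" if "k \<in> insert i I" for k
      using cc that J by auto
    \<comment> \<open>Elimination of \<open>p\<close>: these coefficients vanish in the equation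
      \<open>i\<close>, so only the equations in \<open>I\<close> remain, with one unknown
      fewer.\<close>
    define c' where "c' j k = u j \<otimes> c j k \<ominus> w j \<otimes> c p k" for j k
    have c'c: "c' j k \<in> carrier R" if "j \<in> J'" "k \<in> insert i I" for j k
      using that u w cJ cp by (auto simp: c'_def)
    have "card I < card J'"
      using insert.prems insert.hyps p by (simp add: J'_def)
    then obtain y where y: "y \<in> J' \<rightarrow> carrier R" "\<exists>j\<in>J'. y j \<noteq> \<zero>"
      "\<forall>k\<in>I. (\<Oplus>j\<in>J'. y j \<otimes> c' j k) = \<zero>"
      using insert.IH[OF fin, of c'] c'c by auto
    have yc: "\<And>j. j \<in> J' \<Longrightarrow> y j \<in> carrier R" using y by auto
    \<comment> \<open>Back substitution: expanding \<open>c'\<close> in the combination with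
      coefficients \<open>y\<close> leaves \<open>y j \<otimes> u j\<close> at \<open>c j\<close>,
      while the factors of \<open>c p\<close> add up to \<open>x p\<close>.\<close>
    define x where "x j = (if j = p then (\<Oplus>j\<in>J'. \<ominus> (y j \<otimes> w j)) else y j \<otimes> u j)" for j
    have xp: "x p = (\<Oplus>j\<in>J'. \<ominus> (y j \<otimes> w j))" by (simp add: x_def)
    have xc: "x \<in> J \<rightarrow> carrier R"
      using yc u w by (auto simp: x_def J intro!: finsum_closed)
    have "\<exists>j\<in>J. x j \<noteq> \<zero>"
    proof -
      obtain j where j: "j \<in> J'" "y j \<noteq> \<zero>" using y by auto
      then have "y j \<otimes> u j \<noteq> \<zero>" using integral u u0 yc by metis
      then show ?thesis using j pJ by (auto simp: J x_def)
    qed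
    moreover have key: "(\<Oplus>j\<in>J. x j \<otimes> c j k) = (\<Oplus>j\<in>J'. y j \<otimes> c' j k)"
      if k: "k \<in> insert i I" for k
    proof -
      have "(\<Oplus>j\<in>J. x j \<otimes> c j k) = x p \<otimes> c p k \<oplus> (\<Oplus>j\<in>J'. x j \<otimes> c j k)"
        unfolding J using fin pJ xc cJ cp k
        by (subst finsum_insert) (auto simp: J Pi_def)
      also have "x p \<otimes> c p k = (\<Oplus>j\<in>J'. \<ominus> (y j \<otimes> w j) \<otimes> c p k)"
        unfolding xp using fin yc w cp[OF k] by (subst finsum_ldistr) auto
      also have "(\<Oplus>j\<in>J'. x j \<otimes> c j k) = (\<Oplus>j\<in>J'. y j \<otimes> (u j \<otimes> c j k))"
        using pJ yc u cJ[OF _ k] by (intro finsum_cong') (auto simp: x_def m_assoc)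
      also have "(\<Oplus>j\<in>J'. \<ominus> (y j \<otimes> w j) \<otimes> c p k) \<oplus> \<dots> =
          (\<Oplus>j\<in>J'. \<ominus> (y j \<otimes> w j) \<otimes> c p k \<oplus> y j \<otimes> (u j \<otimes> c j k))"
        using yc u w cJ[OF _ k] cp[OF k] by (subst finsum_addf) auto
      also have "\<dots> = (\<Oplus>j\<in>J'. y j \<otimes> c' j k)"
        using yc u w cJ[OF _ k] cp[OF k]
        by (intro finsum_cong')
          (auto simp: c'_def a_minus_def r_distr r_minus l_minus m_assoc a_comm)
      finally show ?thesis .
    qed
    moreover have "(\<Oplus>j\<in>J. x j \<otimes> c j k) = \<zero>" if k: "k \<in> insert i I" for k
    proof (cases "k = i")
      case True
      have "c' j i = \<zero>" if "j \<in> J'" for j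
        using uw that w cp by (simp add: c'_def a_minus_def r_neg)
      then have "(\<Oplus>j\<in>J'. y j \<otimes> c' j i) = (\<Oplus>j\<in>J'. \<zero>)"
        using yc by (intro finsum_cong') auto
      then show ?thesis using key[OF k] True by (simp add: finsum_zero)
    next
      case False
      then show ?thesis using key[OF k] y(3) k by auto
    qed
    ultimately show ?thesis using xc by blast
  qed
qed

end

section \<open>Sumsets\<close>

primrec nfold_sums :: "'g::comm_monoid_add set \<Rightarrow> nat \<Rightarrow> 'g set"
  where
    "nfold_sums S 0 = {0}"
  | "nfold_sums S (Suc n) = (\<lambda>(x, y). x + y) ` (nfold_sums S n \<times> S)"

lemma finite_nfold_sums: "finite S \<Longrightarrow> finite (nfold_sums S n)"
  by (induction n) auto

text \<open>By commutativity a sum of \<open>n\<close> elements of \<open>S\<close> depends only on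
  how often each element occurs, which is at most \<open>n\<close> times. The term
  \<open>((+) s ^^ k s) 0\<close> is the \<open>k s\<close>-fold multiple of
  \<open>s\<close>.\<close>

lemma nfold_sums_subset:
  assumes "finite S"
  shows "nfold_sums S n \<subseteq> (\<lambda>k. \<Sum>s\<in>S. ((+) s ^^ k s) 0) ` (S \<rightarrow>\<^sub>E {..n})"
proof (induction n)
  case 0
  show ?case by (auto intro!: image_eqI[of _ _ "\<lambda>s\<in>S. 0"])
next
  case (Suc n)
  show ?case
  proof
    fix z assume "z \<in> nfold_sums S (Suc n)"
    then obtain y s where z: "z = y + s" "y \<in> nfold_sums S n" "s \<in> S" by auto
    then obtain k where k: "k \<in> S \<rightarrow>\<^sub>E {..n}" "y = (\<Sum>s\<in>S. ((+) s ^^ k s) 0)"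
      using Suc.IH by blast
    have "(\<Sum>t\<in>S. ((+) t ^^ (k(s := Suc (k s))) t) 0)
        = (s + ((+) s ^^ k s) 0) + (\<Sum>t\<in>S - {s}. ((+) t ^^ (k(s := Suc (k s))) t) 0)"
      using assms z by (simp add: sum.remove[of S s])
    also have "(\<Sum>t\<in>S - {s}. ((+) t ^^ (k(s := Suc (k s))) t) 0)
        = (\<Sum>t\<in>S - {s}. ((+) t ^^ k t) 0)"
      by (intro sum.cong) auto
    also have "(s + ((+) s ^^ k s) 0) + \<dots> = z"
      unfolding z(1) k(2) using assms z by (simp add: sum.remove[of S s] add_ac)
    finally have "z = (\<Sum>t\<in>S. ((+) t ^^ (k(s := Suc (k s))) t) 0)" ..
    moreover have "k(s := Suc (k s)) \<in> S \<rightarrow>\<^sub>E {..Suc n}"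
      using k z by (auto simp: PiE_iff extensional_def Pi_def le_Suc_eq)
    ultimately show "z \<in> (\<lambda>k. \<Sum>s\<in>S. ((+) s ^^ k s) 0) ` (S \<rightarrow>\<^sub>E {..Suc n})"
      by blast
  qed
qed

lemma card_nfold_sums_le:
  assumes "finite S"
  shows "card (nfold_sums S n) \<le> Suc n ^ card S"
proof -
  have "card (nfold_sums S n) \<le> card (S \<rightarrow>\<^sub>E {..n})"
    using assms nfold_sums_subset[OF assms] by (meson surj_card_le finite_PiE finite_atMost)
  also have "\<dots> = Suc n ^ card S"
    using assms by (simp add: card_PiE)
  finally show ?thesis .
qed

lemma power_less_two_power: "\<exists>n::nat. Suc n ^ k < 2 ^ n"
proof -
  \<comment> \<open>With \<open>Suc n\<close> a power of two, the claim becomes a comparison of the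
    exponents \<open>(2 * k + 2) * k\<close> and \<open>n\<close>, for which
    \<open>(k + 1)^2 \<le> 4^k\<close> suffices.\<close>
  define n :: nat where "n = 2 ^ (2 * k + 2) - 1"
  have Sn: "Suc n = 2 ^ (2 * k + 2)" by (simp add: n_def)
  have "Suc k \<le> 2 ^ k" by (rule Suc_leI) (rule less_exp)
  then have "Suc k * Suc k \<le> 2 ^ k * 2 ^ k" by (intro mult_le_mono)
  moreover have "Suc n = 4 * (2 ^ k * 2 ^ k)"
    unfolding Sn by (simp add: power_add mult_2)
  ultimately have "(2 * k + 2) * k < n" by (simp add: algebra_simps)
  then have "(2::nat) ^ ((2 * k + 2) * k) < 2 ^ n" by simp
  then show ?thesis using Sn by (metis power_mult)
qed

text \<open>The number of \<open>n\<close>-fold sums grows only polynomially in \<open>n\<close>, so it cannot double in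
  every step.\<close>

lemma small_sumset:
  fixes S :: "'g::comm_monoid_add set"
  assumes "finite S" "S \<subseteq> H" "0 \<in> H" "\<And>x y. x \<in> H \<Longrightarrow> y \<in> H \<Longrightarrow> x + y \<in> H"
  shows "\<exists>U. finite U \<and> U \<subseteq> H \<and> card ((\<lambda>(x, y). x + y) ` (U \<times> S)) < 2 * card U"
proof (rule ccontr)
  assume no: "\<not> ?thesis"
  have sub: "nfold_sums S n \<subseteq> H" for n
    using assms by (induction n) auto
  have "2 ^ n \<le> card (nfold_sums S n)" for n
  proof (induction n)
    case (Suc n)
    have "\<not> card (nfold_sums S (Suc n)) < 2 * card (nfold_sums S n)"
      using no sub[of n] finite_nfold_sums[OF assms(1), of n] by auto
    then show ?case using Suc by simp
  qed simp
  then show False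
    using card_nfold_sums_le[OF assms(1)] power_less_two_power[of "card S"]
    by (meson le_trans not_less)
qed

text \<open>If a coordinate \<open>i\<close> is not constant on one of the sets, both sets are cut
  down to their elements with maximal \<open>i\<close>-coordinate. A sum of two such elements arises
  only from such elements, and the total cardinality drops, so induction applies. If every
  coordinate is constant on both sets, they are singletons.\<close>

lemma unique_sum:
  fixes S T :: "('i \<Rightarrow> int) set"
  assumes "finite S" "finite T" "S \<noteq> {}" "T \<noteq> {}"
  shows "\<exists>g\<in>S. \<exists>h\<in>T. \<forall>g'\<in>S. \<forall>h'\<in>T. g' + h' = g + h \<longrightarrow> g' = g \<and> h' = h"
  using assms
proof (induction "card S + card T" arbitrary: S T rule: less_induct)
  case less
  show ?case
  proof (cases "\<exists>i. (\<exists>g\<in>S. \<exists>g'\<in>S. g i \<noteq> g' i) \<or> (\<exists>h\<in>T. \<exists>h'\<in>T. h i \<noteq> h' i)")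
    case False
    then have "\<forall>g\<in>S. \<forall>g'\<in>S. g = g'" "\<forall>h\<in>T. \<forall>h'\<in>T. h = h'" by blast+
    then show ?thesis using less.prems by blast
  next
    case True
    then obtain i where i: "(\<exists>g\<in>S. \<exists>g'\<in>S. g i \<noteq> g' i) \<or> (\<exists>h\<in>T. \<exists>h'\<in>T. h i \<noteq> h' i)" ..
    define top where "top X = {g \<in> X. g i = Max ((\<lambda>g. g i) ` X)}" for X :: "('i \<Rightarrow> int) set"
    have sub: "top X \<subseteq> X" for X by (auto simp: top_def)
    have ne: "top X \<noteq> {}" if "finite X" "X \<noteq> {}" for X
    proof -
      have "Max ((\<lambda>g. g i) ` X) \<in> (\<lambda>g. g i) ` X" using that by (intro Max_in) auto
      then show ?thesis by (auto simp: top_def)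
    qed
    have le: "g i \<le> Max ((\<lambda>g. g i) ` X)" if "finite X" "g \<in> X" for X g
      using that by simp
    have ps: "top X \<subset> X" if "g \<in> X" "g' \<in> X" "g i \<noteq> g' i" for X g g'
    proof -
      have "g \<notin> top X \<or> g' \<notin> top X" using that(3) by (simp add: top_def)
      then show ?thesis using sub[of X] that(1,2) by auto
    qed
    have "card (top S) \<le> card S" "card (top T) \<le> card T"
      using card_mono[OF less.prems(1) sub] card_mono[OF less.prems(2) sub] by auto
    moreover have "top S \<subset> S \<or> top T \<subset> T" using i ps by meson
    then have "card (top S) < card S \<or> card (top T) < card T"
      using less.prems psubset_card_mono by meson
    ultimately have "card (top S) + card (top T) < card S + card T" by linarith
    from less.hyps[OF this finite_subset[OF sub less.prems(1)] finite_subset[OF sub less.prems(2)]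
        ne[OF less.prems(1,3)] ne[OF less.prems(2,4)]]
    obtain g h where gh: "g \<in> top S" "h \<in> top T"
      and un: "\<forall>g'\<in>top S. \<forall>h'\<in>top T. g' + h' = g + h \<longrightarrow> g' = g \<and> h' = h"
      by (elim bexE)
    have "g' = g \<and> h' = h" if "g' \<in> S" "h' \<in> T" "g' + h' = g + h" for g' h'
    proof -
      have "g' i + h' i = g i + h i" using that(3) by (metis plus_fun_apply)
      moreover have "g' i \<le> g i" "h' i \<le> h i"
        using le[OF less.prems(1) that(1)] le[OF less.prems(2) that(2)] gh by (auto simp: top_def)
      ultimately have "g' \<in> top S" "h' \<in> top T"
        using that gh by (auto simp: top_def)
      then show ?thesis using un that by blast
    qed
    then show ?thesis using gh sub by blast
  qed
qed

section \<open>Graded extensions of Ore domains\<close>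

text \<open>Scalars act from the left through \<open>\<iota>\<close>, and \<open>v\<close> enumerates a basis graded by \<open>H\<close>.\<close>

locale graded_extension = D: nc_domain D + A: nc_domain A
  for D :: "('d, 'm) ring_scheme" and A :: "('a, 'n) ring_scheme" +
  fixes \<iota> :: "'d \<Rightarrow> 'a" and v :: "'g::comm_monoid_add \<Rightarrow> 'a" and H :: "'g set"
  assumes iota: "\<iota> \<in> ring_hom D A"
    and zero_mem: "0 \<in> H"
    and add_mem: "\<lbrakk>g \<in> H; h \<in> H\<rbrakk> \<Longrightarrow> g + h \<in> H"
    and v_closed: "g \<in> H \<Longrightarrow> v g \<in> carrier A"
    and v_scalar: "\<lbrakk>g \<in> H; d \<in> carrier D\<rbrakk> \<Longrightarrow>
      \<exists>e\<in>carrier D. v g \<otimes>\<^bsub>A\<^esub> \<iota> d = \<iota> e \<otimes>\<^bsub>A\<^esub> v g"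
    and v_mult: "\<lbrakk>g \<in> H; h \<in> H\<rbrakk> \<Longrightarrow> \<exists>d\<in>carrier D. v g \<otimes>\<^bsub>A\<^esub> v h = \<iota> d \<otimes>\<^bsub>A\<^esub> v (g + h)"
    and span: "x \<in> carrier A \<Longrightarrow> \<exists>S c. finite S \<and> S \<subseteq> H \<and> c \<in> S \<rightarrow> carrier D \<and>
      x = (\<Oplus>\<^bsub>A\<^esub>g\<in>S. \<iota> (c g) \<otimes>\<^bsub>A\<^esub> v g)"
    and indep: "\<lbrakk>finite S; S \<subseteq> H; c \<in> S \<rightarrow> carrier D; (\<Oplus>\<^bsub>A\<^esub>g\<in>S. \<iota> (c g) \<otimes>\<^bsub>A\<^esub> v g) = \<zero>\<^bsub>A\<^esub>;
      g \<in> S\<rbrakk> \<Longrightarrow> c g = \<zero>\<^bsub>D\<^esub>"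
begin

lemma iota_closed [simp]: "d \<in> carrier D \<Longrightarrow> \<iota> d \<in> carrier A"
  using iota by (rule ring_hom_closed)

lemma iota_add: "d \<in> carrier D \<Longrightarrow> e \<in> carrier D \<Longrightarrow> \<iota> (d \<oplus>\<^bsub>D\<^esub> e) = \<iota> d \<oplus>\<^bsub>A\<^esub> \<iota> e"
  using iota by (rule ring_hom_add)

lemma iota_mult: "d \<in> carrier D \<Longrightarrow> e \<in> carrier D \<Longrightarrow> \<iota> (d \<otimes>\<^bsub>D\<^esub> e) = \<iota> d \<otimes>\<^bsub>A\<^esub> \<iota> e"
  using iota by (rule ring_hom_mult)

lemma iota_zero [simp]: "\<iota> \<zero>\<^bsub>D\<^esub> = \<zero>\<^bsub>A\<^esub>"
  using iota D.ring_axioms A.ring_axioms by (rule ring_hom_zero)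

lemma iota_finsum:
  assumes "finite S" "c \<in> S \<rightarrow> carrier D"
  shows "\<iota> (\<Oplus>\<^bsub>D\<^esub>s\<in>S. c s) = (\<Oplus>\<^bsub>A\<^esub>s\<in>S. \<iota> (c s))"
  using assms by (induction S) (auto simp: iota_add Pi_iff)

definition Span :: "'g set \<Rightarrow> 'a set"
  where "Span W = {(\<Oplus>\<^bsub>A\<^esub>g\<in>W. \<iota> (c g) \<otimes>\<^bsub>A\<^esub> v g) | c. c \<in> W \<rightarrow> carrier D}"

lemma Span_add:
  assumes "finite W" "W \<subseteq> H" "x \<in> Span W" "y \<in> Span W"
  shows "x \<oplus>\<^bsub>A\<^esub> y \<in> Span W"
proof -
  obtain c d where c: "c \<in> W \<rightarrow> carrier D" "x = (\<Oplus>\<^bsub>A\<^esub>g\<in>W. \<iota> (c g) \<otimes>\<^bsub>A\<^esub> v g)"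
    and d: "d \<in> W \<rightarrow> carrier D" "y = (\<Oplus>\<^bsub>A\<^esub>g\<in>W. \<iota> (d g) \<otimes>\<^bsub>A\<^esub> v g)"
    using assms by (auto simp: Span_def)
  have vW: "v g \<in> carrier A" if "g \<in> W" for g using that assms v_closed by auto
  have "x \<oplus>\<^bsub>A\<^esub> y = (\<Oplus>\<^bsub>A\<^esub>g\<in>W. \<iota> (c g) \<otimes>\<^bsub>A\<^esub> v g \<oplus>\<^bsub>A\<^esub> \<iota> (d g) \<otimes>\<^bsub>A\<^esub> v g)"
    unfolding c(2) d(2) using c(1) d(1) vW by (subst A.finsum_addf) (auto simp: Pi_iff)
  also have "\<dots> = (\<Oplus>\<^bsub>A\<^esub>g\<in>W. \<iota> (c g \<oplus>\<^bsub>D\<^esub> d g) \<otimes>\<^bsub>A\<^esub> v g)"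
    using c(1) d(1) vW by (intro A.finsum_cong') (auto simp: Pi_iff iota_add A.l_distr)
  finally show ?thesis
    using c(1) d(1) unfolding Span_def
    by (intro CollectI exI[of _ "\<lambda>g. c g \<oplus>\<^bsub>D\<^esub> d g"]) auto
qed

lemma Span_superset:
  assumes "finite W'" "W \<subseteq> W'" "W' \<subseteq> H" "x \<in> Span W"
  shows "x \<in> Span W'"
proof -
  obtain c where c: "c \<in> W \<rightarrow> carrier D" "x = (\<Oplus>\<^bsub>A\<^esub>g\<in>W. \<iota> (c g) \<otimes>\<^bsub>A\<^esub> v g)"
    using assms by (auto simp: Span_def)
  have vW: "v g \<in> carrier A" if "g \<in> W'" for g using that assms v_closed by auto
  let ?c = "\<lambda>g. if g \<in> W then c g else \<zero>\<^bsub>D\<^esub>"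
  have "x = (\<Oplus>\<^bsub>A\<^esub>g\<in>W'. \<iota> (?c g) \<otimes>\<^bsub>A\<^esub> v g)"
    unfolding c(2) using assms c(1) vW
    by (intro A.add.finprod_mono_neutral_cong_left) (auto simp: Pi_iff)
  then show ?thesis
    using c(1) unfolding Span_def by (intro CollectI exI[of _ ?c]) auto
qed

lemma Span_single:
  assumes "g \<in> H" "d \<in> carrier D"
  shows "\<iota> d \<otimes>\<^bsub>A\<^esub> v g \<in> Span {g}"
  using assms v_closed unfolding Span_def
  by (intro CollectI exI[of _ "\<lambda>_. d"]) auto

lemma zero_Span:
  assumes "W \<subseteq> H"
  shows "\<zero>\<^bsub>A\<^esub> \<in> Span W"
proof -
  have "(\<Oplus>\<^bsub>A\<^esub>g\<in>W. \<iota> \<zero>\<^bsub>D\<^esub> \<otimes>\<^bsub>A\<^esub> v g) = \<zero>\<^bsub>A\<^esub>"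
    using assms v_closed by (intro A.add.finprod_one_eqI) auto
  then show ?thesis
    unfolding Span_def by (intro CollectI exI[of _ "\<lambda>_. \<zero>\<^bsub>D\<^esub>"]) auto
qed

lemma Span_finsum:
  assumes "finite W" "W \<subseteq> H" "finite K" "\<And>k. k \<in> K \<Longrightarrow> f k \<in> Span W"
  shows "(\<Oplus>\<^bsub>A\<^esub>k\<in>K. f k) \<in> Span W"
proof -
  have sub: "Span W \<subseteq> carrier A"
    using assms v_closed by (auto simp: Span_def Pi_iff subset_iff intro!: A.finsum_closed)
  show ?thesis
    using assms(3,4)
  proof (induction K)
    case empty
    then show ?case using zero_Span assms by simp
  next
    case (insert k K)
    then have "f \<in> K \<rightarrow> carrier A" "f k \<in> carrier A" using sub by auto
    then show ?case using insert by (simp add: Span_add assms)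
  qed
qed

text \<open>Moving \<open>v g\<close> past a coefficient changes only the coefficient, and
  multiplying it with \<open>v s\<close> shifts the degree by \<open>g\<close>. So left
  multiplication by \<open>v g\<close> translates the set of degrees.\<close>

lemma mult_Span:
  assumes "finite S" "S \<subseteq> H" "x \<in> Span S" "g \<in> H"
    and W: "finite W" "W \<subseteq> H" "\<And>s. s \<in> S \<Longrightarrow> g + s \<in> W"
  shows "v g \<otimes>\<^bsub>A\<^esub> x \<in> Span W"
proof -
  obtain c where c: "c \<in> S \<rightarrow> carrier D" "x = (\<Oplus>\<^bsub>A\<^esub>s\<in>S. \<iota> (c s) \<otimes>\<^bsub>A\<^esub> v s)"
    using assms by (auto simp: Span_def)
  have cs: "c s \<in> carrier D" "v s \<in> carrier A" if "s \<in> S" for s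
    using that assms(2) v_closed c by auto
  have gc: "v g \<in> carrier A" using assms(4) by (rule v_closed)
  have "v g \<otimes>\<^bsub>A\<^esub> x = (\<Oplus>\<^bsub>A\<^esub>s\<in>S. v g \<otimes>\<^bsub>A\<^esub> (\<iota> (c s) \<otimes>\<^bsub>A\<^esub> v s))"
    unfolding c(2) using assms(1) gc cs by (subst A.finsum_rdistr) auto
  also have "\<dots> \<in> Span W"
  proof (rule Span_finsum)
    fix s assume s: "s \<in> S"
    obtain d where d: "d \<in> carrier D" "v g \<otimes>\<^bsub>A\<^esub> \<iota> (c s) = \<iota> d \<otimes>\<^bsub>A\<^esub> v g"
      using v_scalar[OF assms(4)] cs(1)[OF s] by blast
    have sH: "s \<in> H" using s assms(2) by auto
    obtain e where e: "e \<in> carrier D" "v g \<otimes>\<^bsub>A\<^esub> v s = \<iota> e \<otimes>\<^bsub>A\<^esub> v (g + s)"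
      using v_mult[OF assms(4) sH] by blast
    have gs: "g + s \<in> H" using assms(4) sH by (rule add_mem)
    have "v g \<otimes>\<^bsub>A\<^esub> (\<iota> (c s) \<otimes>\<^bsub>A\<^esub> v s) = \<iota> d \<otimes>\<^bsub>A\<^esub> (v g \<otimes>\<^bsub>A\<^esub> v s)"
      using d cs[OF s] gc by (simp add: A.m_assoc[symmetric])
    also have "\<dots> = \<iota> (d \<otimes>\<^bsub>D\<^esub> e) \<otimes>\<^bsub>A\<^esub> v (g + s)"
      using d e v_closed[OF gs] by (simp add: A.m_assoc iota_mult)
    also have "\<dots> \<in> Span W"
      using Span_superset[OF W(1) _ W(2) Span_single[OF gs, of "d \<otimes>\<^bsub>D\<^esub> e"]] W(3)[OF s] d e by simp
    finally show "v g \<otimes>\<^bsub>A\<^esub> (\<iota> (c s) \<otimes>\<^bsub>A\<^esub> v s) \<in> Span W" .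
  qed (use assms(1) W in auto)
  finally show ?thesis .
qed

text \<open>Comparing coefficients at each degree in \<open>W\<close> gives a system over
  \<open>D\<close> with \<open>card W\<close> equations in \<open>card J\<close> unknowns, which
  \<open>left_linear_system\<close> solves.\<close>

lemma linear_dependence:
  assumes "left_ore D" "finite W" "W \<subseteq> H" "finite J" "card W < card J"
    and w: "\<And>j. j \<in> J \<Longrightarrow> w j \<in> Span W"
  shows "\<exists>x\<in>J \<rightarrow> carrier D. (\<exists>j\<in>J. x j \<noteq> \<zero>\<^bsub>D\<^esub>) \<and> (\<Oplus>\<^bsub>A\<^esub>j\<in>J. \<iota> (x j) \<otimes>\<^bsub>A\<^esub> w j) = \<zero>\<^bsub>A\<^esub>"
proof -
  have "\<exists>c. c \<in> W \<rightarrow> carrier D \<and> w j = (\<Oplus>\<^bsub>A\<^esub>g\<in>W. \<iota> (c g) \<otimes>\<^bsub>A\<^esub> v g)" if "j \<in> J" for j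
    using w[OF that] by (auto simp: Span_def)
  then obtain c where c: "\<And>j. j \<in> J \<Longrightarrow> c j \<in> W \<rightarrow> carrier D"
    and wc: "\<And>j. j \<in> J \<Longrightarrow> w j = (\<Oplus>\<^bsub>A\<^esub>g\<in>W. \<iota> (c j g) \<otimes>\<^bsub>A\<^esub> v g)"
    by metis
  have cc: "c j g \<in> carrier D" if "j \<in> J" "g \<in> W" for j g using c that by auto
  obtain x where x: "x \<in> J \<rightarrow> carrier D" "\<exists>j\<in>J. x j \<noteq> \<zero>\<^bsub>D\<^esub>"
    "\<forall>g\<in>W. (\<Oplus>\<^bsub>D\<^esub>j\<in>J. x j \<otimes>\<^bsub>D\<^esub> c j g) = \<zero>\<^bsub>D\<^esub>"
    using D.left_linear_system[OF assms(1,2,4,5), of c] cc by auto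
  have xc: "x j \<in> carrier D" if "j \<in> J" for j using x that by auto
  have vW: "v g \<in> carrier A" if "g \<in> W" for g using that assms v_closed by auto
  have "(\<Oplus>\<^bsub>A\<^esub>j\<in>J. \<iota> (x j) \<otimes>\<^bsub>A\<^esub> w j) =
      (\<Oplus>\<^bsub>A\<^esub>j\<in>J. \<Oplus>\<^bsub>A\<^esub>g\<in>W. \<iota> (x j \<otimes>\<^bsub>D\<^esub> c j g) \<otimes>\<^bsub>A\<^esub> v g)"
  proof (intro A.finsum_cong')
    fix j assume j: "j \<in> J"
    have "\<iota> (x j) \<otimes>\<^bsub>A\<^esub> w j = (\<Oplus>\<^bsub>A\<^esub>g\<in>W. \<iota> (x j) \<otimes>\<^bsub>A\<^esub> (\<iota> (c j g) \<otimes>\<^bsub>A\<^esub> v g))"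
      unfolding wc[OF j] using assms(2) xc[OF j] cc[OF j] vW by (subst A.finsum_rdistr) auto
    also have "\<dots> = (\<Oplus>\<^bsub>A\<^esub>g\<in>W. \<iota> (x j \<otimes>\<^bsub>D\<^esub> c j g) \<otimes>\<^bsub>A\<^esub> v g)"
      using xc[OF j] cc[OF j] vW
      by (intro A.finsum_cong') (auto simp: iota_mult A.m_assoc)
    finally show "\<iota> (x j) \<otimes>\<^bsub>A\<^esub> w j = (\<Oplus>\<^bsub>A\<^esub>g\<in>W. \<iota> (x j \<otimes>\<^bsub>D\<^esub> c j g) \<otimes>\<^bsub>A\<^esub> v g)" .
  qed (use xc cc vW in \<open>auto intro!: A.finsum_closed\<close>)
  also have "\<dots> = (\<Oplus>\<^bsub>A\<^esub>g\<in>W. \<Oplus>\<^bsub>A\<^esub>j\<in>J. \<iota> (x j \<otimes>\<^bsub>D\<^esub> c j g) \<otimes>\<^bsub>A\<^esub> v g)"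
    using assms xc cc vW by (intro A.finsum_swap) auto
  also have "\<dots> = \<zero>\<^bsub>A\<^esub>"
  proof (rule A.add.finprod_one_eqI)
    fix g assume g: "g \<in> W"
    have "(\<Oplus>\<^bsub>A\<^esub>j\<in>J. \<iota> (x j \<otimes>\<^bsub>D\<^esub> c j g) \<otimes>\<^bsub>A\<^esub> v g) = \<iota> (\<Oplus>\<^bsub>D\<^esub>j\<in>J. x j \<otimes>\<^bsub>D\<^esub> c j g) \<otimes>\<^bsub>A\<^esub> v g"
      using assms(4) xc cc[OF _ g] vW[OF g]
      by (subst iota_finsum) (auto intro!: A.finsum_ldistr[symmetric])
    then show "(\<Oplus>\<^bsub>A\<^esub>j\<in>J. \<iota> (x j \<otimes>\<^bsub>D\<^esub> c j g) \<otimes>\<^bsub>A\<^esub> v g) = \<zero>\<^bsub>A\<^esub>"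
      using x(3) g vW[OF g] by simp
  qed
  finally show ?thesis using x(1,2) by blast
qed

text \<open>Write \<open>x\<close> and \<open>y\<close> over a common finite set \<open>S\<close> of degrees and choose \<open>U\<close> with
  \<open>|U + S| < 2 |U|\<close>. Then the \<open>2 |U|\<close> elements \<open>v\<^sub>g x\<close> and \<open>v\<^sub>g y\<close> with \<open>g \<in> U\<close> are linearly
  dependent.\<close>

lemma left_ore_extension:
  assumes "left_ore D"
  shows "left_ore A"
  unfolding left_ore_def
proof (intro ballI)
  fix x y assume x: "x \<in> carrier A - {\<zero>\<^bsub>A\<^esub>}" and y: "y \<in> carrier A - {\<zero>\<^bsub>A\<^esub>}"
  have xc: "x \<in> carrier A" and yc: "y \<in> carrier A" using x y by auto
  have "\<exists>S. finite S \<and> S \<subseteq> H \<and> z \<in> Span S" if "z \<in> carrier A" for z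
    using span[OF that] by (auto simp: Span_def)
  then obtain S1 S2 where S12: "finite S1" "S1 \<subseteq> H" "x \<in> Span S1" "finite S2" "S2 \<subseteq> H" "y \<in> Span S2"
    using xc yc by meson
  define S where "S = S1 \<union> S2"
  have S: "finite S" "S \<subseteq> H" using S12 by (auto simp: S_def)
  have xS: "x \<in> Span S" and yS: "y \<in> Span S"
    using Span_superset[of S S1 x] Span_superset[of S S2 y] S S12 by (auto simp: S_def)
  obtain U where U: "finite U" "U \<subseteq> H" "card ((\<lambda>(x, y). x + y) ` (U \<times> S)) < 2 * card U"
    using small_sumset[OF S(1,2) zero_mem add_mem] by blast
  define W where "W = (\<lambda>(x, y). x + y) ` (U \<times> S)"
  have W: "finite W" "W \<subseteq> H" "\<And>g s. g \<in> U \<Longrightarrow> s \<in> S \<Longrightarrow> g + s \<in> W"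
    using U S add_mem by (auto simp: W_def)
  have vU: "v g \<in> carrier A" if "g \<in> U" for g using that U v_closed by auto
  \<comment> \<open>The Boolean says which of \<open>x\<close> and \<open>y\<close> is multiplied,
    so there are \<open>2 * card U\<close> indices.\<close>
  define w where "w = (\<lambda>(b, g). v g \<otimes>\<^bsub>A\<^esub> (if b then x else y))"
  let ?J = "(UNIV :: bool set) \<times> U"
  have "card W < card ?J" using U by (simp add: W_def card_cartesian_product)
  moreover have "w j \<in> Span W" if "j \<in> ?J" for j
    using mult_Span[OF S xS _ W(1,2)] mult_Span[OF S yS _ W(1,2)] W(3) that U
    by (auto simp: w_def)
  ultimately obtain c where c: "c \<in> ?J \<rightarrow> carrier D" "\<exists>j\<in>?J. c j \<noteq> \<zero>\<^bsub>D\<^esub>"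
    "(\<Oplus>\<^bsub>A\<^esub>j\<in>?J. \<iota> (c j) \<otimes>\<^bsub>A\<^esub> w j) = \<zero>\<^bsub>A\<^esub>"
    using linear_dependence[OF assms W(1,2), of ?J w] U by auto
  \<comment> \<open>Collecting the terms with the same Boolean turns the dependence into a relation
    between a left multiple of \<open>x\<close> and one of \<open>y\<close>.\<close>
  define comb where "comb b = (\<Oplus>\<^bsub>A\<^esub>g\<in>U. \<iota> (c (b, g)) \<otimes>\<^bsub>A\<^esub> v g)" for b
  have cU: "c (b, g) \<in> carrier D" if "g \<in> U" for b g using c(1) that by auto
  have combc: "comb b \<in> carrier A" for b
    using cU vU by (auto simp: comb_def intro!: A.finsum_closed)
  have part: "(\<Oplus>\<^bsub>A\<^esub>j\<in>{b} \<times> U. \<iota> (c j) \<otimes>\<^bsub>A\<^esub> w j) = comb b \<otimes>\<^bsub>A\<^esub> (if b then x else y)" for b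
  proof -
    have "{b} \<times> U = Pair b ` U" by auto
    then have "(\<Oplus>\<^bsub>A\<^esub>j\<in>{b} \<times> U. \<iota> (c j) \<otimes>\<^bsub>A\<^esub> w j) = (\<Oplus>\<^bsub>A\<^esub>g\<in>U. \<iota> (c (b, g)) \<otimes>\<^bsub>A\<^esub> w (b, g))"
      using cU vU xc yc
      by (simp only:) (subst A.add.finprod_reindex, auto simp: w_def inj_on_def)
    also have "\<dots> = (\<Oplus>\<^bsub>A\<^esub>g\<in>U. \<iota> (c (b, g)) \<otimes>\<^bsub>A\<^esub> v g \<otimes>\<^bsub>A\<^esub> (if b then x else y))"
      using cU vU xc yc by (intro A.finsum_cong') (auto simp: w_def A.m_assoc)
    also have "\<dots> = comb b \<otimes>\<^bsub>A\<^esub> (if b then x else y)"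
      unfolding comb_def using U cU vU xc yc by (intro A.finsum_ldistr[symmetric]) auto
    finally show ?thesis .
  qed
  have "?J = {True} \<times> U \<union> {False} \<times> U" by auto
  then have "\<zero>\<^bsub>A\<^esub> = (\<Oplus>\<^bsub>A\<^esub>j\<in>{True} \<times> U \<union> {False} \<times> U. \<iota> (c j) \<otimes>\<^bsub>A\<^esub> w j)"
    using c(3) by simp
  also have "\<dots> = comb True \<otimes>\<^bsub>A\<^esub> x \<oplus>\<^bsub>A\<^esub> comb False \<otimes>\<^bsub>A\<^esub> y"
    using part[of True] part[of False] U cU vU xc yc
    by (subst A.finsum_Un_disjoint) (auto simp: w_def)
  finally have sum0: "comb True \<otimes>\<^bsub>A\<^esub> x \<oplus>\<^bsub>A\<^esub> comb False \<otimes>\<^bsub>A\<^esub> y = \<zero>\<^bsub>A\<^esub>" ..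
  then have eq: "comb True \<otimes>\<^bsub>A\<^esub> x = (\<ominus>\<^bsub>A\<^esub> comb False) \<otimes>\<^bsub>A\<^esub> y"
    using combc xc yc by (simp add: A.l_minus A.minus_equality[symmetric])
  \<comment> \<open>If this multiple were zero, so would be the other one; then both factors
    \<open>comb b\<close> would vanish because \<open>A\<close> is a domain, and independence would
    make every coefficient zero.\<close>
  have "comb True \<otimes>\<^bsub>A\<^esub> x \<noteq> \<zero>\<^bsub>A\<^esub>"
  proof
    assume 0: "comb True \<otimes>\<^bsub>A\<^esub> x = \<zero>\<^bsub>A\<^esub>"
    then have "comb False \<otimes>\<^bsub>A\<^esub> y = \<zero>\<^bsub>A\<^esub>" using sum0 combc yc by simp
    then have "comb True = \<zero>\<^bsub>A\<^esub>" "comb False = \<zero>\<^bsub>A\<^esub>"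
      using 0 A.integral combc x y by blast+
    then have "comb b = \<zero>\<^bsub>A\<^esub>" for b by (cases b) auto
    then have "c (b, g) = \<zero>\<^bsub>D\<^esub>" if "g \<in> U" for b g
      using indep[OF U(1,2), of "\<lambda>g. c (b, g)" g] that cU by (auto simp: comb_def)
    then show False using c(2) by auto
  qed
  then show "\<exists>u\<in>carrier A. \<exists>v\<in>carrier A. u \<otimes>\<^bsub>A\<^esub> x = v \<otimes>\<^bsub>A\<^esub> y \<and> u \<otimes>\<^bsub>A\<^esub> x \<noteq> \<zero>\<^bsub>A\<^esub>"
    using eq combc by blast
qed

text \<open>In the opposite ring the scalars stand to the right of \<open>v g\<close>. The
  hypothesis moves them from left to right and \<open>v_scalar\<close> moves them back, so spanning
  and independence carry over term by term. Since degrees commute, \<open>v h\<close> times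
  \<open>v g\<close> still has degree \<open>g + h\<close>.\<close>

lemma graded_extension_opposite:
  assumes "\<And>g d. \<lbrakk>g \<in> H; d \<in> carrier D\<rbrakk> \<Longrightarrow> \<exists>e\<in>carrier D. \<iota> d \<otimes>\<^bsub>A\<^esub> v g = v g \<otimes>\<^bsub>A\<^esub> \<iota> e"
  shows "graded_extension (opposite D) (opposite A) \<iota> v H"
proof -
  \<comment> \<open>Independence on a singleton: a nonzero scalar does not annihilate
    \<open>v g\<close>. In particular \<open>v g\<close> is nonzero and \<open>\<iota>\<close> is
    injective.\<close>
  have iota0: "d = \<zero>\<^bsub>D\<^esub>" if "g \<in> H" "d \<in> carrier D" "\<iota> d \<otimes>\<^bsub>A\<^esub> v g = \<zero>\<^bsub>A\<^esub>" for g d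
    using indep[of "{g}" "\<lambda>_. d" g] that v_closed by auto
  have v0: "v g \<noteq> \<zero>\<^bsub>A\<^esub>" if "g \<in> H" for g
    using iota0[OF that, of "\<one>\<^bsub>D\<^esub>"] D.one_not_zero by auto
  show ?thesis
  proof (intro graded_extension.intro graded_extension_axioms.intro)
    show "nc_domain (opposite D)" "nc_domain (opposite A)"
      by (auto intro: nc_domain_opposite D.nc_domain_axioms A.nc_domain_axioms)
    show "\<iota> \<in> ring_hom (opposite D) (opposite A)"
      using iota by (auto simp: ring_hom_def)
  next
    fix g d assume "g \<in> H" "d \<in> carrier (opposite D)"
    then show "\<exists>e\<in>carrier (opposite D). v g \<otimes>\<^bsub>opposite A\<^esub> \<iota> d = \<iota> e \<otimes>\<^bsub>opposite A\<^esub> v g"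
      using assms by simp
  next
    fix g h assume gh: "g \<in> H" "h \<in> H"
    obtain d where "d \<in> carrier D" "v h \<otimes>\<^bsub>A\<^esub> v g = \<iota> d \<otimes>\<^bsub>A\<^esub> v (g + h)"
      using v_mult[OF gh(2,1)] by (auto simp: add.commute)
    then show "\<exists>d\<in>carrier (opposite D). v g \<otimes>\<^bsub>opposite A\<^esub> v h = \<iota> d \<otimes>\<^bsub>opposite A\<^esub> v (g + h)"
      using assms[of "g + h" d] add_mem[OF gh] by simp
  next
    fix x assume "x \<in> carrier (opposite A)"
    then obtain S c where S: "finite S" "S \<subseteq> H" "c \<in> S \<rightarrow> carrier D"
      "x = (\<Oplus>\<^bsub>A\<^esub>g\<in>S. \<iota> (c g) \<otimes>\<^bsub>A\<^esub> v g)"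
      using span[of x] by auto
    have "\<forall>g\<in>S. \<exists>e. e \<in> carrier D \<and> \<iota> (c g) \<otimes>\<^bsub>A\<^esub> v g = v g \<otimes>\<^bsub>A\<^esub> \<iota> e"
      using assms S by blast
    then obtain e where e: "\<forall>g\<in>S. e g \<in> carrier D \<and> \<iota> (c g) \<otimes>\<^bsub>A\<^esub> v g = v g \<otimes>\<^bsub>A\<^esub> \<iota> (e g)"
      by metis
    have vS: "v g \<in> carrier A" if "g \<in> S" for g using S(2) v_closed that by auto
    have x: "x = (\<Oplus>\<^bsub>A\<^esub>g\<in>S. v g \<otimes>\<^bsub>A\<^esub> \<iota> (e g))"
      unfolding S(4) using e vS by (intro A.finsum_cong') auto
    have "e \<in> S \<rightarrow> carrier D" using e by auto
    then show "\<exists>S c. finite S \<and> S \<subseteq> H \<and> c \<in> S \<rightarrow> carrier (opposite D) \<and>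
        x = (\<Oplus>\<^bsub>opposite A\<^esub>g\<in>S. \<iota> (c g) \<otimes>\<^bsub>opposite A\<^esub> v g)"
      unfolding opposite_simps finsum_opposite using S(1,2) x by blast
  next
    fix S c g
    assume S: "finite S" "S \<subseteq> H" "c \<in> S \<rightarrow> carrier (opposite D)" "g \<in> S"
      and "(\<Oplus>\<^bsub>opposite A\<^esub>g\<in>S. \<iota> (c g) \<otimes>\<^bsub>opposite A\<^esub> v g) = \<zero>\<^bsub>opposite A\<^esub>"
    then have sum: "(\<Oplus>\<^bsub>A\<^esub>g\<in>S. v g \<otimes>\<^bsub>A\<^esub> \<iota> (c g)) = \<zero>\<^bsub>A\<^esub>" by simp
    have "\<exists>e. e \<in> carrier D \<and> v h \<otimes>\<^bsub>A\<^esub> \<iota> (c h) = \<iota> e \<otimes>\<^bsub>A\<^esub> v h" if "h \<in> S" for h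
      using v_scalar[of h "c h"] S(2,3) that by (auto simp: Pi_iff subset_iff)
    then obtain e where e: "\<And>g. g \<in> S \<Longrightarrow> e g \<in> carrier D \<and> v g \<otimes>\<^bsub>A\<^esub> \<iota> (c g) = \<iota> (e g) \<otimes>\<^bsub>A\<^esub> v g"
      by metis
    have vS: "v g \<in> carrier A" if "g \<in> S" for g using S(2) v_closed that by auto
    have "(\<Oplus>\<^bsub>A\<^esub>g\<in>S. v g \<otimes>\<^bsub>A\<^esub> \<iota> (c g)) = (\<Oplus>\<^bsub>A\<^esub>g\<in>S. \<iota> (e g) \<otimes>\<^bsub>A\<^esub> v g)"
      using e vS by (intro A.finsum_cong') auto
    then have "(\<Oplus>\<^bsub>A\<^esub>g\<in>S. \<iota> (e g) \<otimes>\<^bsub>A\<^esub> v g) = \<zero>\<^bsub>A\<^esub>" unfolding sum ..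
    moreover have "e \<in> S \<rightarrow> carrier D" using e by auto
    ultimately have "e g = \<zero>\<^bsub>D\<^esub>" using indep[OF S(1,2)] S(4) by blast
    then have "v g \<otimes>\<^bsub>A\<^esub> \<iota> (c g) = \<zero>\<^bsub>A\<^esub>" using e S(4) vS by simp
    moreover have "g \<in> H" "c g \<in> carrier D" using S by auto
    ultimately have "\<iota> (c g) = \<zero>\<^bsub>A\<^esub>" using A.integral[of "v g" "\<iota> (c g)"] v0 v_closed by auto
    then show "c g = \<zero>\<^bsub>opposite D\<^esub>"
      using iota0[of g "c g"] \<open>g \<in> H\<close> \<open>c g \<in> carrier D\<close> v_closed by simp
  qed (use zero_mem add_mem v_closed in auto)
qed

end

section \<open>The automorphisms\<close>

text \<open>Every rule relates well-formed terms, because \<open>\<sigma>\<close>, the inverses and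
  \<open>a\<close> stay inside \<open>carrier D\<close>. The case \<open>Times_cong\<close> of
  \<open>act_eq\<close> relies on this to keep intermediate functions in the carrier.\<close>

lemma gwa_eq_terms:
  assumes "gwa_eq D \<alpha> a \<sigma> s t" "ring D" "\<And>\<beta>. \<beta> \<in> Field \<alpha> \<Longrightarrow> \<sigma> \<beta> \<in> ring_iso D D"
    "a \<in> Field \<alpha> \<rightarrow> carrier D"
  shows "s \<in> gwa_terms D \<alpha> \<and> t \<in> gwa_terms D \<alpha>"
proof -
  interpret D: ring D by fact
  have aut: "\<sigma> \<beta> d \<in> carrier D" "inv_into (carrier D) (\<sigma> \<beta>) d \<in> carrier D"
    if "\<beta> \<in> Field \<alpha>" "d \<in> carrier D" for \<beta> d
    using ring_iso_memE(1)[OF assms(3)[OF that(1)] that(2)]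
      ring_iso_memE(1)[OF ring_iso_set_sym[OF assms(2) assms(3)[OF that(1)]] that(2)] .
  have a: "a \<beta> \<in> carrier D" if "\<beta> \<in> Field \<alpha>" for \<beta> using assms(4) that by auto
  show ?thesis
    using assms(1)
    by (induction rule: gwa_eq.induct) (auto intro!: gwa_terms.intros simp: aut a)
qed

text \<open>The degree of \<open>X\<^sub>\<beta>\<^sup>+\<close> for \<open>b = True\<close> and of
  \<open>X\<^sub>\<beta>\<^sup>-\<close> for \<open>b = False\<close>. The Boolean selects the sign
  here, in \<open>aut\<close> and in \<open>X\<close>, so that both kinds of generators share one
  proof.\<close>

definition shift :: "bool \<Rightarrow> 'i \<Rightarrow> 'i \<Rightarrow> int"
  where "shift b \<beta> = (\<lambda>\<gamma>. if \<gamma> = \<beta> then if b then 1 else -1 else 0)"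

lemma shift_apply: "shift b \<beta> \<gamma> = (if \<gamma> = \<beta> then if b then 1 else -1 else 0)"
  by (simp add: shift_def)

lemma shift_Not: "shift (\<not> b) \<beta> = - shift b \<beta>"
  by (auto simp: shift_def fun_eq_iff fun_Compl_def)

context gwa_data
begin

abbreviation \<tau> :: "'i \<Rightarrow> 'd \<Rightarrow> 'd"
  where "\<tau> \<beta> \<equiv> inv_into (carrier D) (\<sigma> \<beta>)"

definition aut :: "bool \<Rightarrow> 'i \<Rightarrow> 'd \<Rightarrow> 'd"
  where "aut b \<beta> = (if b then \<sigma> \<beta> else \<tau> \<beta>)"

lemma sigma_iso: "\<beta> \<in> Field \<alpha> \<Longrightarrow> \<sigma> \<beta> \<in> ring_iso D D"
  using sigma_aut by (auto simp: algebra_aut_def)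

lemma aut_iso: "\<beta> \<in> Field \<alpha> \<Longrightarrow> aut b \<beta> \<in> ring_iso D D"
  using sigma_iso ring_iso_set_sym[OF A.ring_axioms sigma_iso] by (auto simp: aut_def)

lemma aut_closed [simp]: "\<beta> \<in> Field \<alpha> \<Longrightarrow> d \<in> carrier D \<Longrightarrow> aut b \<beta> d \<in> carrier D"
  and aut_mult: "\<beta> \<in> Field \<alpha> \<Longrightarrow> d \<in> carrier D \<Longrightarrow> d' \<in> carrier D \<Longrightarrow>
    aut b \<beta> (d \<otimes> d') = aut b \<beta> d \<otimes> aut b \<beta> d'"
  and aut_add: "\<beta> \<in> Field \<alpha> \<Longrightarrow> d \<in> carrier D \<Longrightarrow> d' \<in> carrier D \<Longrightarrow>
    aut b \<beta> (d \<oplus> d') = aut b \<beta> d \<oplus> aut b \<beta> d'"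
  and aut_one [simp]: "\<beta> \<in> Field \<alpha> \<Longrightarrow> aut b \<beta> \<one> = \<one>"
  using ring_iso_memE[OF aut_iso] by auto

lemma aut_zero [simp]: "\<beta> \<in> Field \<alpha> \<Longrightarrow> aut b \<beta> \<zero> = \<zero>"
  using aut_iso by (auto simp: ring_iso_def intro: ring_hom_zero A.ring_axioms)

lemma aut_aut_Not [simp]:
  assumes "\<beta> \<in> Field \<alpha>" "d \<in> carrier D"
  shows "aut b \<beta> (aut (\<not> b) \<beta> d) = d"
  using ring_iso_memE(5)[OF sigma_iso[OF assms(1)]] assms(2)
  by (auto simp: aut_def bij_betw_inv_into_left bij_betw_inv_into_right)

lemma aut_Not_aut [simp]:
  assumes "\<beta> \<in> Field \<alpha>" "d \<in> carrier D"
  shows "aut (\<not> b) \<beta> (aut b \<beta> d) = d"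
  using aut_aut_Not[OF assms, of "\<not> b"] by simp

lemma aut_eq_zero: "\<beta> \<in> Field \<alpha> \<Longrightarrow> d \<in> carrier D \<Longrightarrow> aut b \<beta> d = \<zero> \<longleftrightarrow> d = \<zero>"
  by (metis aut_Not_aut aut_zero)

text \<open>If two bijections commute, each of them commutes with the inverse of the other. Using
  this once settles the mixed signs, and using it again settles two inverses.\<close>

lemma aut_commute:
  assumes "\<beta> \<in> Field \<alpha>" "\<gamma> \<in> Field \<alpha>" "d \<in> carrier D"
  shows "aut b \<beta> (aut c \<gamma> d) = aut c \<gamma> (aut b \<beta> d)"
proof -
  have *: "aut True \<beta> (aut c \<gamma> d) = aut c \<gamma> (aut True \<beta> d)"
    if "\<beta> \<in> Field \<alpha>" "\<gamma> \<in> Field \<alpha>" "d \<in> carrier D" for \<beta> \<gamma> c d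
  proof (cases c)
    case True
    then show ?thesis using that sigma_commute by (simp add: aut_def)
  next
    case False
    have "aut True \<gamma> (aut True \<beta> (aut False \<gamma> d)) = aut True \<beta> (aut True \<gamma> (aut False \<gamma> d))"
      using that sigma_commute aut_closed by (simp add: aut_def[of True])
    also have "\<dots> = aut True \<beta> d" using that aut_aut_Not[of \<gamma> d True] by simp
    finally have "aut False \<gamma> (aut True \<gamma> (aut True \<beta> (aut False \<gamma> d))) = aut False \<gamma> (aut True \<beta> d)"
      by (rule arg_cong)
    then show ?thesis
      using False that aut_Not_aut[of \<gamma> "aut True \<beta> (aut False \<gamma> d)" True] by simp
  qed
  show ?thesis
  proof (cases "b \<or> c")
    case True
    then show ?thesis using *[of \<beta> \<gamma> d c] *[of \<gamma> \<beta> d b] assms by auto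
  next
    case False
    have "aut False \<beta> (aut False \<gamma> (aut True \<beta> (aut False \<beta> d)))
        = aut False \<beta> (aut True \<beta> (aut False \<gamma> (aut False \<beta> d)))"
      using *[of \<beta> \<gamma> "aut False \<beta> d" False] assms by simp
    then show ?thesis
      using False assms aut_aut_Not[of \<beta> _ True] aut_aut_Not[of \<beta> _ False] by simp
  qed
qed

lemma a_closed [simp]: "\<beta> \<in> Field \<alpha> \<Longrightarrow> a \<beta> \<in> carrier D"
  and a_comm: "\<beta> \<in> Field \<alpha> \<Longrightarrow> d \<in> carrier D \<Longrightarrow> a \<beta> \<otimes> d = d \<otimes> a \<beta>"
  using a_center by (auto simp: ring_center_def)

lemma aut_a:
  assumes "\<beta> \<in> Field \<alpha>" "\<gamma> \<in> Field \<alpha>" "\<gamma> \<noteq> \<beta>"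
  shows "aut b \<beta> (a \<gamma>) = a \<gamma>"
  using sigma_a[OF assms] aut_Not_aut[OF assms(1), of "a \<gamma>" True] assms
  by (cases b) (auto simp: aut_def)

text \<open>The zero ring contains no nonzero \<open>a \<beta>\<close>.\<close>

lemma one_neq_zero:
  assumes "Field \<alpha> \<noteq> {}"
  shows "\<one> \<noteq> \<zero>"
proof
  assume 10: "\<one> = \<zero>"
  obtain \<beta> where \<beta>: "\<beta> \<in> Field \<alpha>" using assms by auto
  then have "a \<beta> = \<one> \<otimes> a \<beta>" by simp
  also have "\<dots> = \<zero>" unfolding 10 using \<beta> by simp
  finally show False using a_nonzero \<beta> by blast
qed

section \<open>The action on functions of the degree\<close>

primrec act :: "('d, 'i) gwa_term \<Rightarrow> (('i \<Rightarrow> int) \<Rightarrow> 'd) \<Rightarrow> ('i \<Rightarrow> int) \<Rightarrow> 'd"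
  where
    "act (Const d) f = (\<lambda>m. d \<otimes> f m)"
  | "act (XPlus \<beta>) f = (\<lambda>m. aut True \<beta> (f (m - shift True \<beta>)))"
  | "act (XMinus \<beta>) f = (\<lambda>m. a \<beta> \<otimes> aut False \<beta> (f (m - shift False \<beta>)))"
  | "act (Plus s t) f = (\<lambda>m. act s f m \<oplus> act t f m)"
  | "act (Minus s) f = (\<lambda>m. \<ominus> act s f m)"
  | "act (Times s t) f = act s (act t f)"

abbreviation funs :: "(('i \<Rightarrow> int) \<Rightarrow> 'd) set"
  where "funs \<equiv> UNIV \<rightarrow> carrier D"

lemma act_closed:
  assumes "t \<in> gwa_terms D \<alpha>" "f \<in> funs"
  shows "act t f \<in> funs"
  using assms by (induction arbitrary: f) (auto simp: Pi_iff)

lemma act_closed' [simp]: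
  assumes "t \<in> gwa_terms D \<alpha>" "f \<in> funs"
  shows "act t f m \<in> carrier D"
  using act_closed[OF assms] by auto

lemma gwa_eq_termsD:
  assumes "gwa_eq D \<alpha> a \<sigma> s t"
  shows "s \<in> gwa_terms D \<alpha>" "t \<in> gwa_terms D \<alpha>"
  using gwa_eq_terms[OF assms A.ring_axioms sigma_iso] by auto

lemma act_add:
  assumes "t \<in> gwa_terms D \<alpha>" "f \<in> funs" "g \<in> funs"
  shows "act t (\<lambda>m. f m \<oplus> g m) = (\<lambda>m. act t f m \<oplus> act t g m)"
  using assms
proof (induction arbitrary: f g)
  case (Const d)
  then show ?case by (auto simp: A.r_distr Pi_iff)
next
  case (XPlus \<beta>)
  then show ?case by (auto simp: aut_add Pi_iff)
next
  case (XMinus \<beta>)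
  then show ?case by (auto simp: aut_add A.r_distr Pi_iff)
next
  case (Plus s t)
  then show ?case by (auto simp: M.a_ac)
next
  case (Minus s)
  then show ?case by (auto simp: M.minus_add)
next
  case (Times s t)
  then show ?case by (simp add: act_closed)
qed

text \<open>Soundness of the action, rule by rule, so that it descends to classes. Left
  distributivity rests on \<open>act_add\<close>; the relations between generators with different
  indices rest on the commuting automorphisms and, where \<open>X\<^sub>\<beta>\<^sup>-\<close>
  occurs, on \<open>aut_a\<close>. Centrality of \<open>a \<beta>\<close> lets
  \<open>X\<^sub>\<beta>\<^sup>-\<close> pass a constant.\<close>

lemma act_eq:
  assumes "gwa_eq D \<alpha> a \<sigma> s t" "f \<in> funs"
  shows "act s f = act t f"
  using assms
proof (induction arbitrary: f)
  case (refl t)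
  show ?case ..
next
  case (Times_cong s s' t t')
  then show ?case using act_closed gwa_eq_termsD by simp
next
  case (Plus_Minus s)
  then show ?case by (auto simp: M.l_neg Pi_iff)
next
  case (distrib_left s t u)
  then show ?case by (simp add: act_add act_closed)
next
  case (Const_add d e)
  then show ?case by (auto simp: A.l_distr Pi_iff)
next
  case (Const_mult d e)
  then show ?case by (auto simp: A.m_assoc Pi_iff)
next
  case (XPlus_Const \<beta> d)
  moreover have "\<sigma> \<beta> d = aut True \<beta> d" by (simp add: aut_def)
  ultimately show ?case by (auto simp: aut_mult Pi_iff)
next
  case (XMinus_Const \<beta> d)
  then have "aut False \<beta> d \<in> carrier D" "\<And>m. aut False \<beta> (f m) \<in> carrier D" by (auto simp: Pi_iff)
  moreover have "\<tau> \<beta> d = aut False \<beta> d" by (simp add: aut_def)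
  ultimately show ?case
    using XMinus_Const a_comm[of \<beta> "aut False \<beta> d"]
    by (simp add: aut_mult Pi_iff A.m_assoc[symmetric])
next
  case (XPlus_XPlus \<beta> \<gamma>)
  then show ?case by (auto simp: aut_commute[of \<beta> \<gamma>] Pi_iff diff_diff_eq add.commute)
next
  case (XMinus_XMinus \<beta> \<gamma>)
  then have fc: "\<And>m. f m \<in> carrier D" by auto
  show ?case
  proof (rule ext)
    fix m
    let ?d = "f (m - shift False \<beta> - shift False \<gamma>)"
    have "act (Times (XMinus \<beta>) (XMinus \<gamma>)) f m = a \<beta> \<otimes> a \<gamma> \<otimes> aut False \<beta> (aut False \<gamma> ?d)"
      using XMinus_XMinus fc by (simp add: aut_mult aut_a A.m_assoc)
    also have "\<dots> = a \<gamma> \<otimes> a \<beta> \<otimes> aut False \<gamma> (aut False \<beta> ?d)"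
      using XMinus_XMinus fc a_comm[of \<beta> "a \<gamma>"] aut_commute by simp
    also have "\<dots> = act (Times (XMinus \<gamma>) (XMinus \<beta>)) f m"
      using XMinus_XMinus fc by (simp add: aut_mult aut_a A.m_assoc diff_diff_eq add.commute)
    finally show "act (Times (XMinus \<beta>) (XMinus \<gamma>)) f m = act (Times (XMinus \<gamma>) (XMinus \<beta>)) f m" .
  qed
next
  case (XPlus_XMinus \<beta> \<gamma>)
  then show ?case
    by (auto simp: aut_mult aut_a aut_commute[of \<beta> \<gamma>] Pi_iff diff_diff_eq add.commute)
next
  case (XMinus_XPlus_same \<beta>)
  then show ?case
    using aut_aut_Not[of \<beta> _ False] shift_Not[of True \<beta>] by (auto simp: Pi_iff)
next
  case (XPlus_XMinus_same \<beta>)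
  moreover have "\<sigma> \<beta> (a \<beta>) = aut True \<beta> (a \<beta>)" by (simp add: aut_def)
  ultimately show ?case
    using aut_aut_Not[of \<beta> _ True] shift_Not[of True \<beta>]
    by (auto simp: Pi_iff aut_mult)
qed (auto simp: Pi_iff A.m_assoc M.a_ac A.l_distr)

section \<open>The ring of classes: its generators, their relations and the induced action\<close>

abbreviation \<W> :: "('d, 'i) gwa_term set ring"
  where "\<W> \<equiv> GWA D \<alpha> a \<sigma>"

sublocale GW: ring \<W>
  by (rule ring_GWA) (rule A.ring_axioms)

definition Cst :: "'d \<Rightarrow> ('d, 'i) gwa_term set"
  where "Cst d = gwa_class D \<alpha> a \<sigma> (Const d)"

definition X :: "bool \<Rightarrow> 'i \<Rightarrow> ('d, 'i) gwa_term set"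
  where "X b \<beta> = gwa_class D \<alpha> a \<sigma> (if b then XPlus \<beta> else XMinus \<beta>)"

text \<open>The scalar to which two opposite generators multiply, see
  \<open>X_X_Not\<close>.\<close>

definition XX :: "bool \<Rightarrow> 'i \<Rightarrow> 'd"
  where "XX b \<beta> = (if b then \<sigma> \<beta> (a \<beta>) else a \<beta>)"

lemma carrier_GWA: "carrier \<W> = gwa_class D \<alpha> a \<sigma> ` gwa_terms D \<alpha>"
  by (simp add: GWA_def)

lemma Cst_closed [simp]: "d \<in> carrier D \<Longrightarrow> Cst d \<in> carrier \<W>"
  by (auto simp: carrier_GWA Cst_def intro: gwa_terms.intros)

lemma X_closed [simp]: "\<beta> \<in> Field \<alpha> \<Longrightarrow> X b \<beta> \<in> carrier \<W>"
  by (auto simp: carrier_GWA X_def intro: gwa_terms.intros)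

lemma XX_closed [simp]: "\<beta> \<in> Field \<alpha> \<Longrightarrow> XX b \<beta> \<in> carrier D"
  using aut_closed[of \<beta> "a \<beta>" True] by (simp add: XX_def aut_def)

lemma Cst_zero: "Cst \<zero> = \<zero>\<^bsub>\<W>\<^esub>" and Cst_one: "Cst \<one> = \<one>\<^bsub>\<W>\<^esub>"
  by (simp_all add: Cst_def GWA_def)

lemma Cst_add: "d \<in> carrier D \<Longrightarrow> d' \<in> carrier D \<Longrightarrow> Cst (d \<oplus> d') = Cst d \<oplus>\<^bsub>\<W>\<^esub> Cst d'"
  by (simp add: Cst_def add_gwa_class gwa_terms.intros gwa_class_eq[OF gwa_eq.Const_add])

lemma Cst_mult: "d \<in> carrier D \<Longrightarrow> d' \<in> carrier D \<Longrightarrow> Cst (d \<otimes> d') = Cst d \<otimes>\<^bsub>\<W>\<^esub> Cst d'"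
  by (simp add: Cst_def mult_gwa_class gwa_terms.intros gwa_class_eq[OF gwa_eq.Const_mult])

lemma Cst_hom: "Cst \<in> ring_hom D \<W>"
  by (rule ring_hom_memI) (simp_all add: Cst_one Cst_add Cst_mult)

lemma X_Cst:
  assumes "\<beta> \<in> Field \<alpha>" "d \<in> carrier D"
  shows "X b \<beta> \<otimes>\<^bsub>\<W>\<^esub> Cst d = Cst (aut b \<beta> d) \<otimes>\<^bsub>\<W>\<^esub> X b \<beta>"
proof (cases b)
  case True
  have "aut b \<beta> d = \<sigma> \<beta> d" using True by (simp add: aut_def)
  moreover from this have "\<sigma> \<beta> d \<in> carrier D" using aut_closed[OF assms, of b] by simp
  ultimately show ?thesis
    using True assms
    by (simp add: X_def Cst_def mult_gwa_class gwa_terms.intros gwa_class_eq[OF gwa_eq.XPlus_Const])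
next
  case False
  have "aut b \<beta> d = \<tau> \<beta> d" using False by (simp add: aut_def)
  moreover from this have "\<tau> \<beta> d \<in> carrier D" using aut_closed[OF assms, of b] by simp
  ultimately show ?thesis
    using False assms
    by (simp add: X_def Cst_def mult_gwa_class gwa_terms.intros gwa_class_eq[OF gwa_eq.XMinus_Const])
qed

lemma X_commute:
  assumes "\<beta> \<in> Field \<alpha>" "\<gamma> \<in> Field \<alpha>" "\<beta> \<noteq> \<gamma>"
  shows "X b \<beta> \<otimes>\<^bsub>\<W>\<^esub> X c \<gamma> = X c \<gamma> \<otimes>\<^bsub>\<W>\<^esub> X b \<beta>"
  using assms
  by (cases b; cases c) (simp_all add: X_def mult_gwa_class gwa_terms.intros
      gwa_class_eq[OF gwa_eq.XPlus_XPlus[of \<beta> \<alpha> \<gamma>]] gwa_class_eq[OF gwa_eq.XMinus_XMinus[of \<beta> \<alpha> \<gamma>]]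
      gwa_class_eq[OF gwa_eq.XPlus_XMinus[of \<beta> \<alpha> \<gamma>]] gwa_class_eq[OF gwa_eq.XPlus_XMinus[of \<gamma> \<alpha> \<beta>]])

lemma X_X_Not:
  assumes "\<beta> \<in> Field \<alpha>"
  shows "X b \<beta> \<otimes>\<^bsub>\<W>\<^esub> X (\<not> b) \<beta> = Cst (XX b \<beta>)"
  using assms by (simp add: X_def XX_def Cst_def mult_gwa_class gwa_terms.intros
      gwa_class_eq[OF gwa_eq.XMinus_XPlus_same] gwa_class_eq[OF gwa_eq.XPlus_XMinus_same])

text \<open>The value on a class does not depend on the chosen representative, see \<open>act_eq\<close>.\<close>

definition gact :: "('d, 'i) gwa_term set \<Rightarrow> (('i \<Rightarrow> int) \<Rightarrow> 'd) \<Rightarrow> ('i \<Rightarrow> int) \<Rightarrow> 'd"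
  where "gact x = act (SOME t. t \<in> x)"

lemma gact_class:
  assumes "t \<in> gwa_terms D \<alpha>" "f \<in> funs"
  shows "gact (gwa_class D \<alpha> a \<sigma> t) f = act t f"
proof -
  have "(SOME s. s \<in> gwa_class D \<alpha> a \<sigma> t) \<in> gwa_class D \<alpha> a \<sigma> t"
    by (rule someI) (rule gwa_class_self[OF assms(1)])
  then show ?thesis
    using act_eq[OF _ assms(2)] by (simp add: gact_def gwa_class_def)
qed

lemma gact_closed:
  assumes "x \<in> carrier \<W>" "f \<in> funs"
  shows "gact x f \<in> funs"
proof -
  obtain t where t: "t \<in> gwa_terms D \<alpha>" "x = gwa_class D \<alpha> a \<sigma> t"
    using assms(1) by (auto simp: carrier_GWA)
  show ?thesis
    unfolding t(2) gact_class[OF t(1) assms(2)] by (rule act_closed[OF t(1) assms(2)])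
qed

lemma gact_closed': "x \<in> carrier \<W> \<Longrightarrow> f \<in> funs \<Longrightarrow> gact x f m \<in> carrier D"
  using gact_closed by blast

lemma gact_add:
  assumes "x \<in> carrier \<W>" "y \<in> carrier \<W>" "f \<in> funs"
  shows "gact (x \<oplus>\<^bsub>\<W>\<^esub> y) f m = gact x f m \<oplus> gact y f m"
  using assms by (auto simp: carrier_GWA add_gwa_class gact_class gwa_terms.intros simp del: Pi_iff)

lemma gact_mult:
  assumes "x \<in> carrier \<W>" "y \<in> carrier \<W>" "f \<in> funs"
  shows "gact (x \<otimes>\<^bsub>\<W>\<^esub> y) f = gact x (gact y f)"
  using assms by (auto simp: carrier_GWA mult_gwa_class gact_class act_closed gwa_terms.intros)

lemma gact_Cst:
  assumes "d \<in> carrier D" "f \<in> funs"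
  shows "gact (Cst d) f m = d \<otimes> f m"
  using assms by (simp add: Cst_def gact_class gwa_terms.intros)

lemma gact_X:
  assumes "\<beta> \<in> Field \<alpha>" "f \<in> funs"
  shows "gact (X b \<beta>) f m = (if b then \<one> else a \<beta>) \<otimes> aut b \<beta> (f (m - shift b \<beta>))"
proof -
  have "f n \<in> carrier D" for n using assms(2) by auto
  then show ?thesis using assms by (auto simp: X_def gact_class gwa_terms.intros)
qed

lemma gact_zero:
  assumes "f \<in> funs"
  shows "gact \<zero>\<^bsub>\<W>\<^esub> f m = \<zero>"
proof -
  have "f m \<in> carrier D" using assms by auto
  then show ?thesis
    using gact_Cst[of \<zero> f m] assms by (simp add: Cst_zero)
qed

lemma gact_finsum:
  assumes "finite S" "\<And>s. s \<in> S \<Longrightarrow> x s \<in> carrier \<W>" "f \<in> funs"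
  shows "gact (\<Oplus>\<^bsub>\<W>\<^esub>s\<in>S. x s) f m = (\<Oplus>s\<in>S. gact (x s) f m)"
  using assms(1,2)
proof (induction S)
  case empty
  then show ?case using gact_zero[OF assms(3)] by simp
next
  case (insert s S)
  then have "x \<in> S \<rightarrow> carrier \<W>" "(\<lambda>s. gact (x s) f m) \<in> S \<rightarrow> carrier D"
    "x s \<in> carrier \<W>" "gact (x s) f m \<in> carrier D"
    using gact_closed'[OF _ assms(3)] by auto
  then show ?case
    using insert by (simp add: gact_add GW.finsum_closed assms(3))
qed

section \<open>An ascending chain of left ideals\<close>

lemma not_left_noetherian:
  assumes "infinite (Field \<alpha>)"
  shows "\<not> left_noetherian \<W>"
proof
  assume noeth: "left_noetherian \<W>"
  obtain \<beta> :: "nat \<Rightarrow> 'i" where inj: "inj \<beta>" and \<beta>: "\<And>n. \<beta> n \<in> Field \<alpha>"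
    using infinite_countable_subset[OF assms] by auto
  have 10: "\<one> \<noteq> \<zero>" using assms one_neq_zero by force
  \<comment> \<open>Zero and one are fixed by every automorphism, so
    \<open>X True (\<beta> i)\<close> acts on these functions as a pure translation. The conditions
    accumulate with \<open>n\<close>, so \<open>V n\<close> shrinks and its annihilator
    \<open>I n\<close> grows.\<close>
  define V where "V n = {w. range w \<subseteq> {\<zero>, \<one>} \<and> (\<forall>i<n. \<forall>m. w (m - shift True (\<beta> i)) = w m)}"
    for n
  have V: "w \<in> funs" if "w \<in> V n" for w n using that by (auto simp: V_def)
  define I where "I n = {x \<in> carrier \<W>. \<forall>w\<in>V n. \<forall>m. gact x w m = \<zero>}" for n
  have neg: "gact (\<ominus>\<^bsub>\<W>\<^esub> x) w m = \<zero>" if "x \<in> I n" "w \<in> V n" for x w n m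
  proof -
    have x: "x \<in> carrier \<W>" "gact x w m = \<zero>" using that by (auto simp: I_def)
    have "gact (\<ominus>\<^bsub>\<W>\<^esub> x \<oplus>\<^bsub>\<W>\<^esub> x) w m = \<zero>"
      using x V[OF that(2)] gact_zero by (simp add: GW.l_neg)
    then show ?thesis
      using x V[OF that(2)] gact_closed'[of "\<ominus>\<^bsub>\<W>\<^esub> x" w m] gact_add[of "\<ominus>\<^bsub>\<W>\<^esub> x" x w m]
      by simp
  qed
  have "left_ideal (I n) \<W>" for n
    unfolding left_ideal_def
  proof (intro conjI ballI)
    show "additive_subgroup (I n) \<W>"
    proof (intro additive_subgroup.intro GW.add.subgroupI)
      show "I n \<noteq> {}" using gact_zero V by (auto simp: I_def intro!: exI[of _ "\<zero>\<^bsub>\<W>\<^esub>"])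
    qed (use neg V in \<open>auto simp: I_def gact_add\<close>)
  next
    fix x y assume x: "x \<in> carrier \<W>" and y: "y \<in> I n"
    have "gact (x \<otimes>\<^bsub>\<W>\<^esub> y) w m = \<zero>" if w: "w \<in> V n" for w m
    proof -
      \<comment> \<open>Since \<open>y\<close> sends \<open>w\<close> to the same function as zero
        does, \<open>x \<otimes> y\<close> acts on \<open>w\<close> like
        \<open>x \<otimes> \<zero> = \<zero>\<close>.\<close>
      have "gact y w = gact \<zero>\<^bsub>\<W>\<^esub> w"
        using y w gact_zero[OF V[OF w]] by (auto simp: I_def)
      then have "gact (x \<otimes>\<^bsub>\<W>\<^esub> y) w = gact (x \<otimes>\<^bsub>\<W>\<^esub> \<zero>\<^bsub>\<W>\<^esub>) w"
        using x y V[OF w] by (simp add: gact_mult I_def del: GW.r_null)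
      then show ?thesis using x gact_zero[OF V[OF w]] by simp
    qed
    then show "x \<otimes>\<^bsub>\<W>\<^esub> y \<in> I n" using x y by (auto simp: I_def)
  qed
  moreover have "I n \<subseteq> I (Suc n)" for n
    by (auto simp: I_def V_def)
  ultimately obtain N where N: "\<forall>n\<ge>N. I n = I N"
    using noeth[unfolded left_noetherian_def, rule_format, of I] by blast
  \<comment> \<open>This is \<open>X\<^sub>\<beta>\<^sup>+ - 1\<close> for the index
    \<open>\<beta> N\<close>; on functions with values zero and one it takes the difference of a
    translate and the function itself.\<close>
  define x where "x = X True (\<beta> N) \<oplus>\<^bsub>\<W>\<^esub> Cst (\<ominus> \<one>)"
  have xc: "x \<in> carrier \<W>" using \<beta> by (simp add: x_def)
  have gx: "gact x w m = w (m - shift True (\<beta> N)) \<ominus> w m" if "range w \<subseteq> {\<zero>, \<one>}" for w m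
  proof -
    have w: "w \<in> funs" using that by auto
    have "w n \<in> carrier D" for n using w by auto
    moreover have "aut True (\<beta> N) (w n) = w n" for n
    proof -
      have "w n = \<zero> \<or> w n = \<one>" using that by blast
      then show ?thesis using \<beta>[of N] by auto
    qed
    ultimately show ?thesis
      using w \<beta>[of N]
      by (simp add: x_def gact_add gact_X gact_Cst A.l_minus a_minus_def)
  qed
  have "x \<in> I (Suc N)"
  proof -
    have "gact x w m = \<zero>" if "w \<in> V (Suc N)" for w m
    proof -
      have "w m \<in> carrier D" using V[OF that] by auto
      then show ?thesis using that gx[of w m] by (simp add: V_def M.r_neg a_minus_def)
    qed
    then show ?thesis using xc by (simp add: I_def)
  qed
  moreover have "x \<notin> I N"
  proof -
    \<comment> \<open>The indicator of the hyperplane \<open>m (\<beta> N) = 0\<close> is invariant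
      in the directions \<open>\<beta> i\<close> with \<open>i < N\<close>, as
      \<open>\<beta>\<close> is injective, but not in the direction
      \<open>\<beta> N\<close>.\<close>
    define w where "w m = (if m (\<beta> N) = 0 then \<one> else \<zero>)" for m :: "'i \<Rightarrow> int"
    have rw: "range w \<subseteq> {\<zero>, \<one>}" by (auto simp: w_def)
    have "\<beta> N \<noteq> \<beta> i" if "i < N" for i using inj that by (auto dest: injD)
    then have "w \<in> V N"
      using rw by (auto simp: V_def w_def shift_apply)
    moreover have "gact x w 0 = \<ominus> \<one>"
      unfolding gx[OF rw] by (simp add: w_def shift_apply a_minus_def)
    moreover have "\<ominus> \<one> \<noteq> \<zero>" using 10 by simp
    ultimately show ?thesis unfolding I_def by force
  qed
  ultimately show False using N by (metis le_SucI order_refl)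
qed

section \<open>Reduced monomials\<close>

text \<open>The condition under which multiplying a reduced monomial of degree \<open>g\<close> by
  \<open>X b \<beta>\<close> meets no factor \<open>X (\<not> b) \<beta>\<close>. A degree that is
  zero at \<open>\<beta>\<close> satisfies it for both signs.\<close>

definition ahead :: "bool \<Rightarrow> 'i \<Rightarrow> ('i \<Rightarrow> int) \<Rightarrow> bool"
  where "ahead b \<beta> g \<longleftrightarrow> (if b then 0 \<le> g \<beta> else g \<beta> \<le> 0)"

text \<open>\<open>reduced g x\<close> says that \<open>x\<close> is the monomial of degree \<open>g\<close> that does not involve both
  \<open>X\<^sub>\<beta>\<^sup>+\<close> and \<open>X\<^sub>\<beta>\<^sup>-\<close> for any \<open>\<beta>\<close>.\<close>

inductive reduced :: "('i \<Rightarrow> int) \<Rightarrow> ('d, 'i) gwa_term set \<Rightarrow> bool"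
  where
    one: "reduced 0 \<one>\<^bsub>\<W>\<^esub>"
  | step: "\<lbrakk>reduced g x; \<beta> \<in> Field \<alpha>; ahead b \<beta> g\<rbrakk> \<Longrightarrow> reduced (g + shift b \<beta>) (X b \<beta> \<otimes>\<^bsub>\<W>\<^esub> x)"

lemma reduced_closed: "reduced g x \<Longrightarrow> x \<in> carrier \<W>"
  by (induction rule: reduced.induct) auto

text \<open>The last hypothesis says that \<open>g \<beta>\<close> is nonzero with the sign of
  \<open>b\<close>. So a factor \<open>X b \<beta>\<close> occurs, and it commutes to the front past
  generators with other indices.\<close>

lemma reduced_split:
  assumes "reduced g x" "\<beta> \<in> Field \<alpha>" "\<not> ahead (\<not> b) \<beta> g"
  shows "\<exists>y. reduced (g - shift b \<beta>) y \<and> x = X b \<beta> \<otimes>\<^bsub>\<W>\<^esub> y"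
  using assms(1,3)
proof induction
  case one
  then show ?case by (simp add: ahead_def)
next
  case (step g x \<gamma> c)
  show ?case
  proof (cases "\<gamma> = \<beta>")
    case True
    then have "c = b" using step by (cases b; cases c) (auto simp: ahead_def shift_apply)
    then show ?thesis using True step.hyps by auto
  next
    case False
    then have "\<not> ahead (\<not> b) \<beta> g" using step.prems by (auto simp: ahead_def shift_apply)
    then obtain y where y: "reduced (g - shift b \<beta>) y" "x = X b \<beta> \<otimes>\<^bsub>\<W>\<^esub> y"
      using step.IH by blast
    have yc: "y \<in> carrier \<W>" using y(1) by (rule reduced_closed)
    have "ahead c \<gamma> (g - shift b \<beta>)" using step.hyps False by (simp add: ahead_def shift_apply)
    then have "reduced (g - shift b \<beta> + shift c \<gamma>) (X c \<gamma> \<otimes>\<^bsub>\<W>\<^esub> y)"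
      using y(1) step.hyps(2) by (intro reduced.step)
    moreover have "g - shift b \<beta> + shift c \<gamma> = g + shift c \<gamma> - shift b \<beta>" by simp
    moreover have "X c \<gamma> \<otimes>\<^bsub>\<W>\<^esub> x = X b \<beta> \<otimes>\<^bsub>\<W>\<^esub> (X c \<gamma> \<otimes>\<^bsub>\<W>\<^esub> y)"
      unfolding y(2) using X_commute[OF step.hyps(2) assms(2) False, of c b] yc step.hyps(2) assms(2)
      by (simp add: GW.m_assoc[symmetric])
    ultimately show ?thesis by metis
  qed
qed

text \<open>The front factor of one monomial can be brought to the front of the other by
  \<open>reduced_split\<close>; induction compares what is left.\<close>

lemma reduced_unique:
  assumes "reduced g x" "reduced g y"
  shows "x = y"
  using assms
proof (induction arbitrary: y)
  case one
  then show ?case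
  proof (cases rule: reduced.cases)
    case (step g x \<beta> b)
    \<comment> \<open>A step moves the degree at \<open>\<beta>\<close> away from zero, so it cannot
      end in degree zero.\<close>
    have "g \<beta> + shift b \<beta> \<beta> = 0" using step(1) by (metis plus_fun_apply zero_fun_apply)
    then show ?thesis using step(5) by (cases b) (auto simp: ahead_def shift_apply)
  qed simp
next
  case (step g x \<beta> b)
  have "\<not> ahead (\<not> b) \<beta> (g + shift b \<beta>)"
    using step.hyps(3) by (cases b) (auto simp: ahead_def shift_apply)
  then obtain z where "reduced (g + shift b \<beta> - shift b \<beta>) z" "y = X b \<beta> \<otimes>\<^bsub>\<W>\<^esub> z"
    using reduced_split[OF step.prems step.hyps(2)] by blast
  then show ?case using step.IH by simp
qed

text \<open>Either the new factor meets no opposite factor and the product is reduced, or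
  \<open>X (\<not> b) \<beta>\<close> is split off in front and the two generators multiply to the
  scalar \<open>XX b \<beta>\<close>.\<close>

lemma X_reduced:
  assumes "reduced g x" "\<beta> \<in> Field \<alpha>"
  shows "\<exists>d\<in>carrier D. \<exists>y. reduced (g + shift b \<beta>) y \<and> X b \<beta> \<otimes>\<^bsub>\<W>\<^esub> x = Cst d \<otimes>\<^bsub>\<W>\<^esub> y"
proof (cases "ahead b \<beta> g")
  case True
  then have "reduced (g + shift b \<beta>) (X b \<beta> \<otimes>\<^bsub>\<W>\<^esub> x)" using assms by (intro reduced.step)
  then show ?thesis
    using assms reduced_closed[OF assms(1)] by (intro bexI[of _ \<one>]) (auto simp: Cst_one)
next
  case False
  then obtain y where y: "reduced (g - shift (\<not> b) \<beta>) y" "x = X (\<not> b) \<beta> \<otimes>\<^bsub>\<W>\<^esub> y"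
    using reduced_split[OF assms, of "\<not> b"] by auto
  have "X b \<beta> \<otimes>\<^bsub>\<W>\<^esub> x = Cst (XX b \<beta>) \<otimes>\<^bsub>\<W>\<^esub> y"
    unfolding y(2) X_X_Not[OF assms(2), symmetric]
    using reduced_closed[OF y(1)] assms(2) by (simp add: GW.m_assoc)
  moreover have "reduced (g + shift b \<beta>) y" using y(1) by (simp add: shift_Not)
  ultimately show ?thesis using assms(2) by (intro bexI[of _ "XX b \<beta>"]) auto
qed

lemma reduced_mult:
  assumes "reduced g x" "reduced h y"
  shows "\<exists>d\<in>carrier D. \<exists>z. reduced (g + h) z \<and> x \<otimes>\<^bsub>\<W>\<^esub> y = Cst d \<otimes>\<^bsub>\<W>\<^esub> z"
  using assms(1)
proof induction
  case one
  show ?case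
    using assms(2) reduced_closed[OF assms(2)] by (intro bexI[of _ \<one>]) (auto simp: Cst_one)
next
  case (step g x \<beta> b)
  obtain d z where d: "d \<in> carrier D" and z: "reduced (g + h) z" "x \<otimes>\<^bsub>\<W>\<^esub> y = Cst d \<otimes>\<^bsub>\<W>\<^esub> z"
    using step.IH by blast
  obtain d' z' where d': "d' \<in> carrier D" and z': "reduced (g + h + shift b \<beta>) z'"
    "X b \<beta> \<otimes>\<^bsub>\<W>\<^esub> z = Cst d' \<otimes>\<^bsub>\<W>\<^esub> z'"
    using X_reduced[OF z(1) step.hyps(2), of b] by blast
  note closed = reduced_closed[OF step.hyps(1)] reduced_closed[OF assms(2)]
    reduced_closed[OF z(1)] reduced_closed[OF z'(1)]
  have "X b \<beta> \<otimes>\<^bsub>\<W>\<^esub> x \<otimes>\<^bsub>\<W>\<^esub> y = X b \<beta> \<otimes>\<^bsub>\<W>\<^esub> Cst d \<otimes>\<^bsub>\<W>\<^esub> z"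
    using closed step.hyps(2) d z(2) by (simp add: GW.m_assoc)
  also have "\<dots> = Cst (aut b \<beta> d) \<otimes>\<^bsub>\<W>\<^esub> (X b \<beta> \<otimes>\<^bsub>\<W>\<^esub> z)"
    using closed step.hyps(2) d by (simp add: X_Cst GW.m_assoc)
  also have "\<dots> = Cst (aut b \<beta> d \<otimes> d') \<otimes>\<^bsub>\<W>\<^esub> z'"
    using closed step.hyps(2) d d' z'(2) by (simp add: Cst_mult GW.m_assoc)
  finally have "X b \<beta> \<otimes>\<^bsub>\<W>\<^esub> x \<otimes>\<^bsub>\<W>\<^esub> y = Cst (aut b \<beta> d \<otimes> d') \<otimes>\<^bsub>\<W>\<^esub> z'" .
  moreover have "g + h + shift b \<beta> = g + shift b \<beta> + h" by simp
  ultimately show ?case using d d' z'(1) step.hyps(2) by (metis A.m_closed aut_closed)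
qed

lemma reduced_Cst:
  assumes "reduced g x" "d \<in> carrier D"
  shows "\<exists>e\<in>carrier D. x \<otimes>\<^bsub>\<W>\<^esub> Cst d = Cst e \<otimes>\<^bsub>\<W>\<^esub> x"
  using assms(1)
proof induction
  case one
  show ?case using assms(2) by (intro bexI[of _ d]) auto
next
  case (step g x \<beta> b)
  obtain e where e: "e \<in> carrier D" "x \<otimes>\<^bsub>\<W>\<^esub> Cst d = Cst e \<otimes>\<^bsub>\<W>\<^esub> x" using step.IH by blast
  have "X b \<beta> \<otimes>\<^bsub>\<W>\<^esub> x \<otimes>\<^bsub>\<W>\<^esub> Cst d = X b \<beta> \<otimes>\<^bsub>\<W>\<^esub> Cst e \<otimes>\<^bsub>\<W>\<^esub> x"
    using e assms(2) step.hyps(2) reduced_closed[OF step.hyps(1)] by (simp add: GW.m_assoc)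
  also have "\<dots> = Cst (aut b \<beta> e) \<otimes>\<^bsub>\<W>\<^esub> (X b \<beta> \<otimes>\<^bsub>\<W>\<^esub> x)"
    using e step.hyps(2) reduced_closed[OF step.hyps(1)] by (simp add: X_Cst GW.m_assoc)
  finally show ?case using e step.hyps(2) by (intro bexI[of _ "aut b \<beta> e"]) auto
qed

text \<open>Scalars also pass from left to right, because each automorphism can be inverted. This is
  the hypothesis of \<open>graded_extension_opposite\<close>.\<close>

lemma Cst_reduced:
  assumes "reduced g x" "d \<in> carrier D"
  shows "\<exists>e\<in>carrier D. Cst d \<otimes>\<^bsub>\<W>\<^esub> x = x \<otimes>\<^bsub>\<W>\<^esub> Cst e"
  using assms
proof (induction arbitrary: d)
  case one
  then show ?case by (intro bexI[of _ d]) auto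
next
  case (step g x \<beta> b)
  have d': "aut (\<not> b) \<beta> d \<in> carrier D" using step.hyps(2) step.prems by simp
  then obtain e where e: "e \<in> carrier D" "Cst (aut (\<not> b) \<beta> d) \<otimes>\<^bsub>\<W>\<^esub> x = x \<otimes>\<^bsub>\<W>\<^esub> Cst e"
    using step.IH by blast
  have xc: "x \<in> carrier \<W>" using step.hyps(1) by (rule reduced_closed)
  have "Cst d \<otimes>\<^bsub>\<W>\<^esub> (X b \<beta> \<otimes>\<^bsub>\<W>\<^esub> x) = X b \<beta> \<otimes>\<^bsub>\<W>\<^esub> Cst (aut (\<not> b) \<beta> d) \<otimes>\<^bsub>\<W>\<^esub> x"
    using d' xc step.hyps(2) step.prems by (simp add: X_Cst GW.m_assoc)
  also have "\<dots> = X b \<beta> \<otimes>\<^bsub>\<W>\<^esub> x \<otimes>\<^bsub>\<W>\<^esub> Cst e"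
    using d' e xc step.hyps(2) by (simp add: GW.m_assoc)
  finally show ?case using e(1) by blast
qed

text \<open>These are the integer functions with finite support inside
  \<open>Field \<alpha>\<close>.\<close>

definition degrees :: "('i \<Rightarrow> int) set"
  where "degrees = {g. \<exists>x. reduced g x}"

definition monomial :: "('i \<Rightarrow> int) \<Rightarrow> ('d, 'i) gwa_term set"
  where "monomial g = (THE x. reduced g x)"

lemma monomial_eq: "reduced g x \<Longrightarrow> monomial g = x"
  unfolding monomial_def by (rule the_equality) (assumption, rule reduced_unique)

lemma reduced_monomial: "g \<in> degrees \<Longrightarrow> reduced g (monomial g)"
  using monomial_eq by (auto simp: degrees_def)

lemma monomial_closed [simp]: "g \<in> degrees \<Longrightarrow> monomial g \<in> carrier \<W>"
  using reduced_closed reduced_monomial by blast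

section \<open>Spanning and independence\<close>

text \<open>Linear combinations in which a degree may occur several times, which makes the closure
  properties plain inductions; equal degrees are collected only in \<open>combs_sum\<close>.\<close>

inductive_set combs :: "('d, 'i) gwa_term set set"
  where
    zero: "\<zero>\<^bsub>\<W>\<^esub> \<in> combs"
  | add: "\<lbrakk>x \<in> combs; g \<in> degrees; d \<in> carrier D\<rbrakk> \<Longrightarrow> Cst d \<otimes>\<^bsub>\<W>\<^esub> monomial g \<oplus>\<^bsub>\<W>\<^esub> x \<in> combs"

lemma combs_closed: "x \<in> combs \<Longrightarrow> x \<in> carrier \<W>"
  by (induction rule: combs.induct) auto

lemma combs_add:
  assumes "x \<in> combs" "y \<in> combs"
  shows "x \<oplus>\<^bsub>\<W>\<^esub> y \<in> combs"
  using assms(1)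
proof induction
  case zero
  then show ?case using assms(2) combs_closed by simp
next
  case (add x g d)
  then show ?case
    using combs.add[OF add.IH add.hyps(2,3)] combs_closed assms(2) by (simp add: GW.a_assoc)
qed

lemma Cst_combs:
  assumes "x \<in> combs" "e \<in> carrier D"
  shows "Cst e \<otimes>\<^bsub>\<W>\<^esub> x \<in> combs"
  using assms(1)
proof induction
  case zero
  show ?case using assms(2) by (simp add: combs.zero)
next
  case (add x g d)
  have "Cst e \<otimes>\<^bsub>\<W>\<^esub> (Cst d \<otimes>\<^bsub>\<W>\<^esub> monomial g \<oplus>\<^bsub>\<W>\<^esub> x) = Cst (e \<otimes> d) \<otimes>\<^bsub>\<W>\<^esub> monomial g \<oplus>\<^bsub>\<W>\<^esub> Cst e \<otimes>\<^bsub>\<W>\<^esub> x"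
    using add.hyps combs_closed assms(2) by (simp add: GW.r_distr GW.m_assoc Cst_mult)
  then show ?case using combs.add[OF add.IH add.hyps(2)] add.hyps(3) assms(2) by simp
qed

lemma X_combs:
  assumes "x \<in> combs" "\<beta> \<in> Field \<alpha>"
  shows "X b \<beta> \<otimes>\<^bsub>\<W>\<^esub> x \<in> combs"
  using assms(1)
proof induction
  case zero
  show ?case using assms(2) by (simp add: combs.zero)
next
  case (add x g d)
  have xc: "x \<in> carrier \<W>" using add.hyps(1) by (rule combs_closed)
  obtain d' y where d': "d' \<in> carrier D" and y: "reduced (g + shift b \<beta>) y"
    "X b \<beta> \<otimes>\<^bsub>\<W>\<^esub> monomial g = Cst d' \<otimes>\<^bsub>\<W>\<^esub> y"
    using X_reduced[OF reduced_monomial[OF add.hyps(2)] assms(2)] by blast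
  have deg: "g + shift b \<beta> \<in> degrees" using y(1) by (auto simp: degrees_def)
  have yc: "y \<in> carrier \<W>" using y(1) by (rule reduced_closed)
  have "X b \<beta> \<otimes>\<^bsub>\<W>\<^esub> (Cst d \<otimes>\<^bsub>\<W>\<^esub> monomial g \<oplus>\<^bsub>\<W>\<^esub> x) =
      X b \<beta> \<otimes>\<^bsub>\<W>\<^esub> Cst d \<otimes>\<^bsub>\<W>\<^esub> monomial g \<oplus>\<^bsub>\<W>\<^esub> X b \<beta> \<otimes>\<^bsub>\<W>\<^esub> x"
    using add.hyps xc assms(2) by (simp add: GW.r_distr GW.m_assoc)
  also have "X b \<beta> \<otimes>\<^bsub>\<W>\<^esub> Cst d \<otimes>\<^bsub>\<W>\<^esub> monomial g = Cst (aut b \<beta> d) \<otimes>\<^bsub>\<W>\<^esub> (Cst d' \<otimes>\<^bsub>\<W>\<^esub> y)"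
    unfolding y(2)[symmetric] using add.hyps assms(2) by (simp add: X_Cst GW.m_assoc)
  also have "\<dots> = Cst (aut b \<beta> d \<otimes> d') \<otimes>\<^bsub>\<W>\<^esub> monomial (g + shift b \<beta>)"
    using d' yc add.hyps(3) assms(2) by (simp add: Cst_mult GW.m_assoc monomial_eq[OF y(1)])
  finally show ?case
    using combs.add[OF add.IH deg, of "aut b \<beta> d \<otimes> d'"] d' add.hyps(3) assms(2) by simp
qed

lemma zero_degree: "0 \<in> degrees"
  using reduced.one by (auto simp: degrees_def)

lemma monomial_zero: "monomial 0 = \<one>\<^bsub>\<W>\<^esub>"
  using reduced.one by (rule monomial_eq)

lemma minus_Cst:
  assumes "x \<in> carrier \<W>"
  shows "\<ominus>\<^bsub>\<W>\<^esub> x = Cst (\<ominus> \<one>) \<otimes>\<^bsub>\<W>\<^esub> x"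
proof -
  have "Cst (\<ominus> \<one>) \<otimes>\<^bsub>\<W>\<^esub> x \<oplus>\<^bsub>\<W>\<^esub> x = Cst (\<ominus> \<one> \<oplus> \<one>) \<otimes>\<^bsub>\<W>\<^esub> x"
    using assms by (simp add: Cst_add GW.l_distr Cst_one)
  also have "\<dots> = \<zero>\<^bsub>\<W>\<^esub>" using assms by (simp add: M.l_neg Cst_zero)
  finally show ?thesis using assms by (intro GW.minus_equality) auto
qed

text \<open>Carrying the right factor \<open>x\<close> along makes the case \<open>Times\<close>
  immediate by associativity. Applied to \<open>x\<close> equal to one, the statement yields
  \<open>monomial_span\<close>.\<close>

lemma term_combs:
  assumes "t \<in> gwa_terms D \<alpha>" "x \<in> combs"
  shows "gwa_class D \<alpha> a \<sigma> t \<otimes>\<^bsub>\<W>\<^esub> x \<in> combs"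
  using assms
proof (induction arbitrary: x)
  case (Const d)
  then show ?case using Cst_combs by (simp add: Cst_def)
next
  case (XPlus \<beta>)
  then show ?case using X_combs[of x \<beta> True] by (simp add: X_def)
next
  case (XMinus \<beta>)
  then show ?case using X_combs[of x \<beta> False] by (simp add: X_def)
next
  case (Plus s t)
  then have c: "gwa_class D \<alpha> a \<sigma> s \<in> carrier \<W>" "gwa_class D \<alpha> a \<sigma> t \<in> carrier \<W>"
    by (auto simp: carrier_GWA)
  then show ?case
    using Plus combs_add[OF Plus.IH] combs_closed
    by (simp add: add_gwa_class[symmetric] GW.l_distr)
next
  case (Minus s)
  have c: "gwa_class D \<alpha> a \<sigma> s \<in> carrier \<W>" "gwa_class D \<alpha> a \<sigma> (Minus s) \<in> carrier \<W>"
    using Minus.hyps by (auto simp: carrier_GWA intro: gwa_terms.intros)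
  have "gwa_class D \<alpha> a \<sigma> (Minus s) \<oplus>\<^bsub>\<W>\<^esub> gwa_class D \<alpha> a \<sigma> s = \<zero>\<^bsub>\<W>\<^esub>"
    using Minus.hyps
    by (simp add: add_gwa_class gwa_terms.intros gwa_class_eq[OF gwa_eq.Plus_Minus]
        Cst_zero[symmetric] Cst_def)
  then have "gwa_class D \<alpha> a \<sigma> (Minus s) = Cst (\<ominus> \<one>) \<otimes>\<^bsub>\<W>\<^esub> gwa_class D \<alpha> a \<sigma> s"
    using c GW.minus_equality[of "gwa_class D \<alpha> a \<sigma> (Minus s)" "gwa_class D \<alpha> a \<sigma> s"]
    by (simp add: minus_Cst)
  then show ?case
    using c Cst_combs[OF Minus.IH[OF Minus.prems], of "\<ominus> \<one>"] combs_closed[OF Minus.prems]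
    by (simp add: GW.m_assoc)
next
  case (Times s t)
  then have c: "gwa_class D \<alpha> a \<sigma> s \<in> carrier \<W>" "gwa_class D \<alpha> a \<sigma> t \<in> carrier \<W>"
    by (auto simp: carrier_GWA)
  then show ?case
    using Times combs_closed by (simp add: mult_gwa_class[symmetric] GW.m_assoc)
qed

lemma combs_sum:
  assumes "x \<in> combs"
  shows "\<exists>S c. finite S \<and> S \<subseteq> degrees \<and> c \<in> S \<rightarrow> carrier D \<and>
    x = (\<Oplus>\<^bsub>\<W>\<^esub>g\<in>S. Cst (c g) \<otimes>\<^bsub>\<W>\<^esub> monomial g)"
  using assms
proof induction
  case zero
  then show ?case by (intro exI[of _ "{}"]) auto
next
  case (add x g d)
  then obtain S c where S: "finite S" "S \<subseteq> degrees" "c \<in> S \<rightarrow> carrier D"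
    and x: "x = (\<Oplus>\<^bsub>\<W>\<^esub>g\<in>S. Cst (c g) \<otimes>\<^bsub>\<W>\<^esub> monomial g)"
    by auto
  have cS: "c h \<in> carrier D" "monomial h \<in> carrier \<W>" if "h \<in> S" for h using S that by auto
  \<comment> \<open>A degree that occurs already gets the sum of its two coefficients;
    \<open>R\<close> below collects the untouched terms.\<close>
  define c' where "c' = c(g := if g \<in> S then d \<oplus> c g else d)"
  have c': "c' \<in> insert g S \<rightarrow> carrier D" using cS add.hyps by (auto simp: c'_def)
  have c'S: "c' h \<in> carrier D" "monomial h \<in> carrier \<W>" if "h \<in> insert g S" for h
    using c' cS(2) add.hyps(2) that by auto
  define R where "R = (\<Oplus>\<^bsub>\<W>\<^esub>h\<in>S - {g}. Cst (c h) \<otimes>\<^bsub>\<W>\<^esub> monomial h)"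
  have Rc: "R \<in> carrier \<W>" using cS by (auto simp: R_def intro!: GW.finsum_closed)
  have "insert g S = insert g (S - {g})" by auto
  then have "(\<Oplus>\<^bsub>\<W>\<^esub>h\<in>insert g S. Cst (c' h) \<otimes>\<^bsub>\<W>\<^esub> monomial h) =
      Cst (c' g) \<otimes>\<^bsub>\<W>\<^esub> monomial g \<oplus>\<^bsub>\<W>\<^esub> (\<Oplus>\<^bsub>\<W>\<^esub>h\<in>S - {g}. Cst (c' h) \<otimes>\<^bsub>\<W>\<^esub> monomial h)"
    using S(1) c'S by (simp only:) (subst GW.finsum_insert, auto)
  also have "(\<Oplus>\<^bsub>\<W>\<^esub>h\<in>S - {g}. Cst (c' h) \<otimes>\<^bsub>\<W>\<^esub> monomial h) = R"
    unfolding R_def using cS by (intro GW.finsum_cong') (auto simp: c'_def)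
  finally have sum': "(\<Oplus>\<^bsub>\<W>\<^esub>h\<in>insert g S. Cst (c' h) \<otimes>\<^bsub>\<W>\<^esub> monomial h) =
      Cst (c' g) \<otimes>\<^bsub>\<W>\<^esub> monomial g \<oplus>\<^bsub>\<W>\<^esub> R" .
  have "Cst d \<otimes>\<^bsub>\<W>\<^esub> monomial g \<oplus>\<^bsub>\<W>\<^esub> x = Cst (c' g) \<otimes>\<^bsub>\<W>\<^esub> monomial g \<oplus>\<^bsub>\<W>\<^esub> R"
  proof (cases "g \<in> S")
    case True
    then have "S = insert g (S - {g})" by auto
    then have "x = (\<Oplus>\<^bsub>\<W>\<^esub>h\<in>insert g (S - {g}). Cst (c h) \<otimes>\<^bsub>\<W>\<^esub> monomial h)" using x by simp
    also have "\<dots> = Cst (c g) \<otimes>\<^bsub>\<W>\<^esub> monomial g \<oplus>\<^bsub>\<W>\<^esub> R"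
      unfolding R_def using S(1) cS True by (subst GW.finsum_insert) auto
    finally show ?thesis
      using True cS[OF True] add.hyps Rc by (simp add: c'_def Cst_add GW.l_distr GW.a_assoc)
  next
    case False
    then show ?thesis using x by (simp add: c'_def R_def)
  qed
  then show ?case
    using sum' S(1,2) c' add.hyps(2) by (intro exI[of _ "insert g S"] exI[of _ c']) auto
qed

lemma monomial_span:
  assumes "x \<in> carrier \<W>"
  shows "\<exists>S c. finite S \<and> S \<subseteq> degrees \<and> c \<in> S \<rightarrow> carrier D \<and>
    x = (\<Oplus>\<^bsub>\<W>\<^esub>g\<in>S. Cst (c g) \<otimes>\<^bsub>\<W>\<^esub> monomial g)"
proof -
  obtain t where t: "t \<in> gwa_terms D \<alpha>" "x = gwa_class D \<alpha> a \<sigma> t"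
    using assms by (auto simp: carrier_GWA)
  have "Cst \<one> \<otimes>\<^bsub>\<W>\<^esub> monomial 0 \<oplus>\<^bsub>\<W>\<^esub> \<zero>\<^bsub>\<W>\<^esub> \<in> combs"
    by (intro combs.intros zero_degree A.one_closed)
  then have "\<one>\<^bsub>\<W>\<^esub> \<in> combs" by (simp add: monomial_zero Cst_one)
  then have "x \<in> combs" using term_combs[OF t(1), of "\<one>\<^bsub>\<W>\<^esub>"] assms t(2) by simp
  then show ?thesis by (rule combs_sum)
qed

text \<open>The Laurent polynomial one. Applying an element to it exposes the coefficients of that
  element up to nonzero factors, see \<open>gact_delta\<close>.\<close>

definition delta :: "('i \<Rightarrow> int) \<Rightarrow> 'd"
  where "delta m = (if m = 0 then \<one> else \<zero>)"

lemma delta_funs: "delta \<in> funs"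
  by (auto simp: delta_def)

lemma gact_one:
  assumes "f \<in> funs"
  shows "gact \<one>\<^bsub>\<W>\<^esub> f m = f m"
proof -
  have "f m \<in> carrier D" using assms by auto
  then show ?thesis using gact_Cst[OF A.one_closed assms, of m] by (simp add: Cst_one)
qed

section \<open>Base ring a domain: independence, zero divisors and the Ore condition\<close>

context
  assumes domain: "nc_domain D"
begin

text \<open>A reduced monomial translates by its degree and applies to the values a composite
  \<open>\<theta>\<close> of automorphisms and multiplications by elements \<open>a \<beta>\<close>.
  Over a domain such a composite vanishes only at zero.\<close>

lemma gact_reduced:
  assumes "reduced g x"
  shows "\<exists>\<theta>. \<theta> \<in> carrier D \<rightarrow> carrier D \<and> (\<forall>d\<in>carrier D. \<theta> d = \<zero> \<longleftrightarrow> d = \<zero>) \<and>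
    (\<forall>f\<in>funs. \<forall>m. gact x f m = \<theta> (f (m - g)))"
  using assms
proof induction
  case one
  show ?case by (intro exI[of _ id]) (auto simp: gact_one)
next
  case (step g x \<beta> b)
  obtain \<theta> where \<theta>: "\<theta> \<in> carrier D \<rightarrow> carrier D" "\<forall>d\<in>carrier D. \<theta> d = \<zero> \<longleftrightarrow> d = \<zero>"
    "\<forall>f\<in>funs. \<forall>m. gact x f m = \<theta> (f (m - g))"
    using step.IH by blast
  have \<theta>c: "\<theta> d \<in> carrier D" if "d \<in> carrier D" for d using \<theta>(1) that by auto
  define p where "p = (if b then \<one> else a \<beta>)"
  have p: "p \<in> carrier D" "p \<noteq> \<zero>"
    using step.hyps(2) a_nonzero nc_domain.one_not_zero[OF domain] by (auto simp: p_def)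
  define \<theta>' where "\<theta>' d = p \<otimes> aut b \<beta> (\<theta> d)" for d
  have "\<theta>' \<in> carrier D \<rightarrow> carrier D"
    using p(1) \<theta>c step.hyps(2) by (auto simp: \<theta>'_def)
  moreover have "\<theta>' d = \<zero> \<longleftrightarrow> d = \<zero>" if d: "d \<in> carrier D" for d
  proof -
    have "\<theta>' d = \<zero> \<longleftrightarrow> aut b \<beta> (\<theta> d) = \<zero>"
      using nc_domain.integral[OF domain p(1), of "aut b \<beta> (\<theta> d)"] p \<theta>c[OF d] step.hyps(2)
      by (auto simp: \<theta>'_def)
    then show ?thesis using \<theta>(2) \<theta>c[OF d] step.hyps(2) d by (simp add: aut_eq_zero)
  qed
  moreover have "gact (X b \<beta> \<otimes>\<^bsub>\<W>\<^esub> x) f m = \<theta>' (f (m - (g + shift b \<beta>)))" if f: "f \<in> funs" for f m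
  proof -
    have "gact (X b \<beta> \<otimes>\<^bsub>\<W>\<^esub> x) f m = p \<otimes> aut b \<beta> (gact x f (m - shift b \<beta>))"
      using step.hyps(2) reduced_closed[OF step.hyps(1)] f
      by (simp add: gact_mult gact_X gact_closed p_def)
    also have "\<dots> = \<theta>' (f (m - (g + shift b \<beta>)))"
      using \<theta>(3) f by (simp add: \<theta>'_def diff_diff_eq add.commute)
    finally show ?thesis .
  qed
  ultimately show ?case by blast
qed

definition twist :: "('i \<Rightarrow> int) \<Rightarrow> 'd \<Rightarrow> 'd"
  where "twist g = (SOME \<theta>. \<theta> \<in> carrier D \<rightarrow> carrier D \<and> (\<forall>d\<in>carrier D. \<theta> d = \<zero> \<longleftrightarrow> d = \<zero>) \<and>
    (\<forall>f\<in>funs. \<forall>m. gact (monomial g) f m = \<theta> (f (m - g))))"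

lemma twist:
  assumes "g \<in> degrees"
  shows "d \<in> carrier D \<Longrightarrow> twist g d \<in> carrier D"
    and "d \<in> carrier D \<Longrightarrow> twist g d = \<zero> \<longleftrightarrow> d = \<zero>"
    and "f \<in> funs \<Longrightarrow> gact (monomial g) f m = twist g (f (m - g))"
  using someI_ex[OF gact_reduced[OF reduced_monomial[OF assms]], folded twist_def] by auto

lemma gact_sum:
  assumes "finite S" "S \<subseteq> degrees" "c \<in> S \<rightarrow> carrier D" "f \<in> funs"
  shows "gact (\<Oplus>\<^bsub>\<W>\<^esub>g\<in>S. Cst (c g) \<otimes>\<^bsub>\<W>\<^esub> monomial g) f m = (\<Oplus>g\<in>S. c g \<otimes> twist g (f (m - g)))"
proof -
  have S: "c g \<in> carrier D" "g \<in> degrees" if "g \<in> S" for g using assms that by auto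
  have fc: "f n \<in> carrier D" for n using assms(4) by auto
  have "gact (\<Oplus>\<^bsub>\<W>\<^esub>g\<in>S. Cst (c g) \<otimes>\<^bsub>\<W>\<^esub> monomial g) f m =
      (\<Oplus>g\<in>S. gact (Cst (c g) \<otimes>\<^bsub>\<W>\<^esub> monomial g) f m)"
    using S by (intro gact_finsum assms) auto
  also have "\<dots> = (\<Oplus>g\<in>S. c g \<otimes> twist g (f (m - g)))"
    using S fc assms(4)
    by (intro M.finsum_cong') (auto simp: gact_mult gact_Cst gact_closed twist)
  finally show ?thesis .
qed

lemma gact_sum_single:
  assumes "finite S" "S \<subseteq> degrees" "c \<in> S \<rightarrow> carrier D" "f \<in> funs"
    and "g \<in> S" "\<And>h. h \<in> S \<Longrightarrow> h \<noteq> g \<Longrightarrow> f (m - h) = \<zero>"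
  shows "gact (\<Oplus>\<^bsub>\<W>\<^esub>g\<in>S. Cst (c g) \<otimes>\<^bsub>\<W>\<^esub> monomial g) f m = c g \<otimes> twist g (f (m - g))"
proof -
  have S: "c h \<in> carrier D" "h \<in> degrees" if "h \<in> S" for h using assms that by auto
  have fc: "f n \<in> carrier D" for n using assms(4) by auto
  have tw0: "twist h \<zero> = \<zero>" if "h \<in> S" for h using twist(2)[OF S(2)[OF that], of \<zero>] by simp
  have "(\<Oplus>h\<in>S. c h \<otimes> twist h (f (m - h))) =
      (\<Oplus>h\<in>S. if g = h then c h \<otimes> twist h (f (m - h)) else \<zero>)"
    using S fc assms(6) by (intro M.finsum_cong') (auto simp: twist tw0)
  also have "\<dots> = c g \<otimes> twist g (f (m - g))"
    using S fc assms(1,5) by (intro M.finsum_singleton) (auto simp: twist)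
  finally show ?thesis using gact_sum[OF assms(1-4)] by simp
qed

lemma gact_delta:
  assumes "finite S" "S \<subseteq> degrees" "c \<in> S \<rightarrow> carrier D" "g \<in> S"
  shows "gact (\<Oplus>\<^bsub>\<W>\<^esub>g\<in>S. Cst (c g) \<otimes>\<^bsub>\<W>\<^esub> monomial g) delta g = c g \<otimes> twist g \<one>"
  using gact_sum_single[OF assms(1-3) delta_funs assms(4), of g] by (simp add: delta_def)

lemma coefficient_twist_eq_zero:
  assumes "g \<in> degrees" "c \<in> carrier D" "d \<in> carrier D"
  shows "c \<otimes> twist g d = \<zero> \<longleftrightarrow> c = \<zero> \<or> d = \<zero>"
  using nc_domain.integral[OF domain, of c "twist g d"] twist(1,2)[OF assms(1,3)] assms(2) by auto

text \<open>Acting on \<open>delta\<close> and evaluating at \<open>g\<close> isolates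
  \<open>c g\<close>, up to a nonzero right factor.\<close>

lemma monomial_indep:
  assumes "finite S" "S \<subseteq> degrees" "c \<in> S \<rightarrow> carrier D" "g \<in> S"
    and "(\<Oplus>\<^bsub>\<W>\<^esub>g\<in>S. Cst (c g) \<otimes>\<^bsub>\<W>\<^esub> monomial g) = \<zero>\<^bsub>\<W>\<^esub>"
  shows "c g = \<zero>"
proof -
  have "c g \<otimes> twist g \<one> = \<zero>"
    using gact_delta[OF assms(1-4)] assms(5) gact_zero[OF delta_funs] by simp
  moreover have "g \<in> degrees" "c g \<in> carrier D" using assms by auto
  ultimately show ?thesis
    using coefficient_twist_eq_zero[of g "c g" \<one>] nc_domain.one_not_zero[OF domain] by auto
qed

text \<open>Discarding the zero coefficients leaves a nonempty set of degrees, as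
  \<open>unique_sum\<close> requires.\<close>

lemma nonzero_span:
  assumes "x \<in> carrier \<W>" "x \<noteq> \<zero>\<^bsub>\<W>\<^esub>"
  shows "\<exists>S c. finite S \<and> S \<noteq> {} \<and> S \<subseteq> degrees \<and> c \<in> S \<rightarrow> carrier D - {\<zero>} \<and>
    x = (\<Oplus>\<^bsub>\<W>\<^esub>g\<in>S. Cst (c g) \<otimes>\<^bsub>\<W>\<^esub> monomial g)"
proof -
  obtain S c where S: "finite S" "S \<subseteq> degrees" "c \<in> S \<rightarrow> carrier D"
    and x: "x = (\<Oplus>\<^bsub>\<W>\<^esub>g\<in>S. Cst (c g) \<otimes>\<^bsub>\<W>\<^esub> monomial g)"
    using monomial_span[OF assms(1)] by blast
  define T where "T = {g \<in> S. c g \<noteq> \<zero>}"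
  have cS: "c g \<in> carrier D" "monomial g \<in> carrier \<W>" if "g \<in> S" for g using S that by auto
  have xT: "x = (\<Oplus>\<^bsub>\<W>\<^esub>g\<in>T. Cst (c g) \<otimes>\<^bsub>\<W>\<^esub> monomial g)"
    unfolding x using S(1) cS
    by (intro GW.add.finprod_mono_neutral_cong_right) (auto simp: T_def Cst_zero)
  then have "T \<noteq> {}" using assms(2) by auto
  moreover have "finite T" "T \<subseteq> degrees" "c \<in> T \<rightarrow> carrier D - {\<zero>}"
    using S by (auto simp: T_def)
  ultimately show ?thesis using xT by blast
qed

text \<open>The product acts on \<open>delta\<close>, and the result is evaluated at a sum
  \<open>g + h\<close> that arises in only one way. A single pair of terms contributes, so nothing
  cancels and the value is nonzero.\<close>

lemma nc_domain_GWA: "nc_domain \<W>"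
proof (intro nc_domain.intro nc_domain_axioms.intro GW.ring_axioms)
  note D10 = nc_domain.one_not_zero[OF domain]
  show "\<one>\<^bsub>\<W>\<^esub> \<noteq> \<zero>\<^bsub>\<W>\<^esub>"
  proof
    assume "\<one>\<^bsub>\<W>\<^esub> = \<zero>\<^bsub>\<W>\<^esub>"
    then have "delta 0 = \<zero>" using gact_one[OF delta_funs, of 0] gact_zero[OF delta_funs, of 0] by simp
    then show False using D10 by (simp add: delta_def)
  qed
  fix x y assume x: "x \<in> carrier \<W>" and y: "y \<in> carrier \<W>" and xy: "x \<otimes>\<^bsub>\<W>\<^esub> y = \<zero>\<^bsub>\<W>\<^esub>"
  show "x = \<zero>\<^bsub>\<W>\<^esub> \<or> y = \<zero>\<^bsub>\<W>\<^esub>"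
  proof (rule ccontr)
    assume "\<not> ?thesis"
    then have x0: "x \<noteq> \<zero>\<^bsub>\<W>\<^esub>" and y0: "y \<noteq> \<zero>\<^bsub>\<W>\<^esub>" by auto
    obtain S c where S: "finite S" "S \<noteq> {}" "S \<subseteq> degrees" "c \<in> S \<rightarrow> carrier D - {\<zero>}"
      and xS: "x = (\<Oplus>\<^bsub>\<W>\<^esub>g\<in>S. Cst (c g) \<otimes>\<^bsub>\<W>\<^esub> monomial g)"
      using nonzero_span[OF x x0] by blast
    obtain T e where T: "finite T" "T \<noteq> {}" "T \<subseteq> degrees" "e \<in> T \<rightarrow> carrier D - {\<zero>}"
      and yT: "y = (\<Oplus>\<^bsub>\<W>\<^esub>g\<in>T. Cst (e g) \<otimes>\<^bsub>\<W>\<^esub> monomial g)"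
      using nonzero_span[OF y y0] by blast
    have c: "c \<in> S \<rightarrow> carrier D" and e: "e \<in> T \<rightarrow> carrier D" using S T by auto
    obtain g h where g: "g \<in> S" and h: "h \<in> T"
      and un: "\<forall>g'\<in>S. \<forall>h'\<in>T. g' + h' = g + h \<longrightarrow> g' = g \<and> h' = h"
      using unique_sum[OF S(1) T(1) S(2) T(2)] by blast
    \<comment> \<open>The image of \<open>delta\<close> under \<open>y\<close> is supported on
      \<open>T\<close>, which allows the product to be evaluated in two stages.\<close>
    define f where "f = gact y delta"
    have f: "f \<in> funs" unfolding f_def using y delta_funs by (rule gact_closed)
    have f_out: "f m = \<zero>" if m: "m \<notin> T" for m
    proof -
      have "e k \<otimes> twist k (delta (m - k)) = \<zero>" if "k \<in> T" for k
      proof -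
        have "delta (m - k) = \<zero>" using that m by (auto simp: delta_def)
        moreover have "k \<in> degrees" "e k \<in> carrier D" using that T e by auto
        ultimately show ?thesis using coefficient_twist_eq_zero[of k "e k" "\<zero>"] by simp
      qed
      then show ?thesis
        unfolding f_def yT gact_sum[OF T(1,3) e delta_funs] by (intro M.add.finprod_one_eqI)
    qed
    \<comment> \<open>A nonzero value would put \<open>g + h - k\<close> into \<open>T\<close> and
      so write \<open>g + h\<close> as a second sum, with \<open>k\<close> in place of
      \<open>g\<close>.\<close>
    have "f (g + h - k) = \<zero>" if "k \<in> S" "k \<noteq> g" for k
    proof (rule f_out)
      show "g + h - k \<notin> T"
      proof
        assume "g + h - k \<in> T"
        then have "k + (g + h - k) = g + h \<longrightarrow> k = g" using un that(1) by blast
        then show False using that(2) by simp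
      qed
    qed
    then have "gact x f (g + h) = c g \<otimes> twist g (f (g + h - g))"
      unfolding xS by (intro gact_sum_single S c f g)
    moreover have "gact x f (g + h) = \<zero>"
      using gact_mult[OF x y delta_funs] gact_zero[OF delta_funs] by (simp add: xy f_def)
    moreover have "f h = e h \<otimes> twist h \<one>"
      unfolding f_def yT by (rule gact_delta[OF T(1,3) e h])
    moreover have "h \<in> degrees" "e h \<in> carrier D" "e h \<noteq> \<zero>" "g \<in> degrees" "c g \<in> carrier D" "c g \<noteq> \<zero>"
      using S T g h by auto
    moreover have "f h \<in> carrier D" using f by auto
    ultimately show False
      using coefficient_twist_eq_zero[of g "c g" "f h"] coefficient_twist_eq_zero[of h "e h" \<one>] D10
      by simp
  qed
qed

lemma graded_extension_GWA: "graded_extension D \<W> Cst monomial degrees"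
proof (intro graded_extension.intro graded_extension_axioms.intro domain nc_domain_GWA Cst_hom
    zero_degree)
  fix g h assume gh: "g \<in> degrees" "h \<in> degrees"
  obtain d z where d: "d \<in> carrier D" "reduced (g + h) z"
    "monomial g \<otimes>\<^bsub>\<W>\<^esub> monomial h = Cst d \<otimes>\<^bsub>\<W>\<^esub> z"
    using reduced_mult[OF gh[THEN reduced_monomial]] by blast
  then show "g + h \<in> degrees" by (auto simp: degrees_def)
  show "\<exists>d\<in>carrier D. monomial g \<otimes>\<^bsub>\<W>\<^esub> monomial h = Cst d \<otimes>\<^bsub>\<W>\<^esub> monomial (g + h)"
    using d monomial_eq by blast
next
  fix g d assume "g \<in> degrees" "d \<in> carrier D"
  then show "\<exists>e\<in>carrier D. monomial g \<otimes>\<^bsub>\<W>\<^esub> Cst d = Cst e \<otimes>\<^bsub>\<W>\<^esub> monomial g"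
    by (rule reduced_Cst[OF reduced_monomial])
qed (use monomial_span monomial_indep in auto)

lemma ore_domain_GWA:
  assumes "noetherian D"
  shows "ore_domain \<W>"
proof (rule ore_domainI[OF nc_domain_GWA])
  interpret E: graded_extension D \<W> Cst monomial degrees by (rule graded_extension_GWA)
  \<comment> \<open>For the right-hand half, the opposite ring is a graded extension of
    \<open>opposite D\<close>, whose left ideals are the right ideals of \<open>D\<close>.\<close>
  interpret opp: graded_extension "opposite D" "opposite \<W>" Cst monomial degrees
    by (rule E.graded_extension_opposite) (rule Cst_reduced[OF reduced_monomial])
  show "left_ore \<W>"
    using assms E.D.left_noetherian_imp_left_ore by (intro E.left_ore_extension) (simp add: noetherian_def)
  show "left_ore (opposite \<W>)"
    using assms opp.D.left_noetherian_imp_left_ore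
    by (intro opp.left_ore_extension) (simp add: noetherian_def left_noetherian_opposite)
qed

end

end

theorem corollary6p11:
  fixes K :: "('k, 'm) ring_scheme" and D :: "('k, 'd, 'n) module_scheme"
    and \<alpha> :: "'i rel" and a :: "'i \<Rightarrow> 'd" and \<sigma> :: "'i \<Rightarrow> 'd \<Rightarrow> 'd"
  assumes "gwa_data K D \<alpha> a \<sigma>"
    and "infinite (Field \<alpha>)"
  shows "\<not> noetherian (GWA D \<alpha> a \<sigma>) \<and>
    (nc_domain D \<longrightarrow> nc_domain (GWA D \<alpha> a \<sigma>)) \<and>
    (nc_domain D \<and> noetherian D \<longrightarrow> ore_domain (GWA D \<alpha> a \<sigma>))"
proof -
  interpret gwa_data K D \<alpha> a \<sigma> by fact
  show ?thesis
    using not_left_noetherian[OF assms(2)] nc_domain_GWA ore_domain_GWA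
    by (simp add: noetherian_def)
qed

end
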